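(* Let $T$ be a splitting tree. Then the following are equivalent: (1) $\mathrm{wsacks}_{\mathrm{baire}}(T)$; (2) $\mathrm{wsacks}_{\mathrm{cont}}(T)$; (3) there is a splitting tree $S \subseteq T$ such that for every $s \in S$, $S \restriction s$ is finitely covering.
   Context: A tree is a set $T \subseteq 2^{<\omega}$ closed under initial segments; $[T]$ is its set of infinite branches. For $t \in T$, $T \restriction t = \{ s \in T : s \subseteq t \text{ or } t \subseteq s\}$. For $a \subseteq \omega$ and $X \subseteq 2^{\leq \omega}$, $X$ covers $a$ if for every $n \in a$ and $i \in 2$ there is $s \in X$ with $n \in \operatorname{dom}(s)$ and $s(n) = i$. A tree $T \subseteq 2^{<\omega}$ is a splitting tree if for every $t \in T$, $T \restriction t$ covers a cofinite subset of $\omega$. Splitting forcing $\mathbb{SP}$ is the set of splitting trees ordered by inclusion; $\dot x_{\mathrm{gen}}$ denotes the $\mathbb{SP}$-name for the generic real (the union of the stems of the trees in the generic filter). A splitting tree $T$ is finitely covering if there is a finite set $X \subseteq [T]$ that covers a cofinite subset of $\omega$. For a splitting tree $T$ and a class $\Gamma$ of functions $f \colon [T] \to \omega^\omega$ (here $\Gamma$ is either the class of Baire-measurable functions, giving $\mathrm{wsacks}_{\mathrm{baire}}$, or the class of continuous functions, giving $\mathrm{wsacks}_{\mathrm{cont}}$), $\mathrm{wsacks}_\Gamma(T)$ means: for every $g \colon \omega \to \omega$ with $g(n) \to \infty$ and every $f \in \Gamma$, there are a splitting tree $S \subseteq T$, $a \in [\omega]^\omega$ and $H \in \prod_{n \in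 a} [\omega]^{g(n)}$ such that $S \Vdash_{\mathbb{SP}} \forall n \in a\, (f(\dot x_{\mathrm{gen}})(n) \in H(n))$, where $f(\dot x_{\mathrm{gen}})$ is the name for the value of $f$ at the generic real. Here $[\omega]^k$ is the set of $k$-element subsets of $\omega$.
   Formalization: "Baire-measurable" is taken in the restricted sense (preimages of open sets have the Baire property relative to every subspace of [T]; all Borel functions qualify); with the Baire property relative to [T] only, f at the generic real can be meaningless and (3)⇒(1) fails. *)

theory Defs
  imports "HOL-Analysis.Analysis" "HOL-Library.Sublist"
begin

section \<open>Splitting trees\<close>

text \<open>Finite binary sequences are Boolean lists and reals are functions \<open>nat \<Rightarrow> bool\<close>, with the product
  topology of the library. To let finite and infinite sequences be treated alike, both are viewed
  as partial functions from \<open>\<omega>\<close> to \<open>2\<close> when we speak of covering.\<close>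

type_synonym tree = "bool list set"
type_synonym point = "nat \<Rightarrow> bool"

definition is_tree :: "tree \<Rightarrow> bool" where
  "is_tree T \<longleftrightarrow> (\<forall>t\<in>T. \<forall>s. prefix s t \<longrightarrow> s \<in> T)"

definition branches :: "tree \<Rightarrow> point set" where
  "branches T = {x. \<forall>k. map x [0..<k] \<in> T}"

definition restrict_tree :: "tree \<Rightarrow> bool list \<Rightarrow> tree" where
  "restrict_tree T t = {s \<in> T. prefix s t \<or> prefix t s}"

definition fin_seq :: "bool list \<Rightarrow> (nat \<rightharpoonup> bool)" where
  "fin_seq t = (\<lambda>n. if n < length t then Some (t ! n) else None)"

definition inf_seq :: "point \<Rightarrow> (nat \<rightharpoonup> bool)" where
  "inf_seq x = (\<lambda>n. Some (x n))"

definition covers :: "(nat \<rightharpoonup> bool) set \<Rightarrow> nat set \<Rightarrow> bool" where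
  "covers X a \<longleftrightarrow> (\<forall>n\<in>a. \<forall>i. \<exists>s\<in>X. s n = Some i)"

definition covers_cofinite :: "(nat \<rightharpoonup> bool) set \<Rightarrow> bool" where
  "covers_cofinite X \<longleftrightarrow> (\<exists>a. finite (- a) \<and> covers X a)"

text \<open>Splitting trees are forcing conditions, so the empty tree, which would satisfy the covering
  requirement vacuously, has to be excluded.\<close>

definition splitting_tree :: "tree \<Rightarrow> bool" where
  "splitting_tree T \<longleftrightarrow>
     is_tree T \<and> T \<noteq> {} \<and> (\<forall>t\<in>T. covers_cofinite (fin_seq ` restrict_tree T t))"

definition finitely_covering :: "tree \<Rightarrow> bool" where
  "finitely_covering T \<longleftrightarrow>
     splitting_tree T \<and> (\<exists>X\<subseteq>branches T. finite X \<and> covers_cofinite (inf_seq ` X))"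

definition stem :: "tree \<Rightarrow> bool list" where
  "stem T = (ARG_MAX length t. t \<in> T \<and> restrict_tree T t = T)"

section \<open>Splitting forcing\<close>

text \<open>A forcing statement is identified with the predicate of being a condition that forces it, and
  the following are the usual recursive clauses of the forcing relation. A name for a subset of a
  ground model set \<open>A\<close> is a set of pairs \<open>(a, p)\<close>, read as \<open>p\<close> putting \<open>a\<close> into the set. In
  particular, a name for a real is a name for its graph.\<close>

type_synonym stmt = "tree \<Rightarrow> bool"
type_synonym 'a name = "('a \<times> tree) set"

definition dense_below :: "tree \<Rightarrow> (tree \<Rightarrow> bool) \<Rightarrow> bool" where
  "dense_below p D \<longleftrightarrow>
     (\<forall>q. splitting_tree q \<and> q \<subseteq> p \<longrightarrow> (\<exists>r. splitting_tree r \<and> r \<subseteq> q \<and> D r))"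

definition forces :: "tree \<Rightarrow> stmt \<Rightarrow> bool" (infix "\<tturnstile>" 45) where
  "p \<tturnstile> \<phi> \<longleftrightarrow> splitting_tree p \<and> \<phi> p"

definition f_mem :: "'a \<Rightarrow> 'a name \<Rightarrow> stmt" where
  "f_mem a \<tau> = (\<lambda>p. dense_below p (\<lambda>r. \<exists>s. (a, s) \<in> \<tau> \<and> r \<subseteq> s))"

definition f_all :: "'a set \<Rightarrow> ('a \<Rightarrow> stmt) \<Rightarrow> stmt" where
  "f_all A \<phi> = (\<lambda>p. \<forall>a\<in>A. \<phi> a p)"

definition f_ex :: "'a set \<Rightarrow> ('a \<Rightarrow> stmt) \<Rightarrow> stmt" where
  "f_ex A \<phi> = (\<lambda>p. dense_below p (\<lambda>r. \<exists>a\<in>A. \<phi> a r))"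

text \<open>The generic real is the union of the stems of the conditions in the generic filter.\<close>

definition x_gen :: "(nat \<times> bool) name" where
  "x_gen = {((n, i), p) | n i p. splitting_tree p \<and> n < length (stem p) \<and> stem p ! n = i}"

text \<open>The statement that the real named by \<open>\<tau>\<close> is a branch of the ground model tree \<open>q\<close>, that is,
  that all of its finite initial segments are in \<open>q\<close>.\<close>

definition f_branch :: "(nat \<times> bool) name \<Rightarrow> tree \<Rightarrow> stmt" where
  "f_branch \<tau> q =
     f_all UNIV (\<lambda>k. f_ex {t \<in> q. length t = k} (\<lambda>t. f_all {..<k} (\<lambda>i. f_mem (i, t ! i) \<tau>)))"

text \<open>The name for \<open>f(\<tau>)\<close>, where \<open>f\<close> is a function on \<open>[T]\<close> and \<open>\<tau>\<close> names a real: the value at \<open>n\<close> is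
  \<open>m\<close> as soon as the generic filter contains a condition forcing \<open>\<tau>\<close> to be a branch of some
  ground model tree \<open>q \<subseteq> T\<close> such that \<open>f(x)(n) = m\<close> for all \<open>x \<in> [q]\<close>. For Borel \<open>f\<close>, the statement
  that \<open>f(x)(n) = m\<close> for all \<open>x \<in> [q]\<close> is coanalytic, hence absolute, so this is compatible with
  the evaluation of a Borel code. At the generic real, and for every \<open>f\<close> that is Baire measurable
  as below, every condition below \<open>T\<close> has an extension \<open>p\<close> with \<open>f\<close> continuous on \<open>[p]\<close>, so
  that the value at every \<open>n\<close> is decided densely often.\<close>

definition value_name ::
    "tree \<Rightarrow> (point \<Rightarrow> nat \<Rightarrow> nat) \<Rightarrow> (nat \<times> bool) name \<Rightarrow> (nat \<times> nat) name" where
  "value_name T f \<tau> = {((n, m), p) | n m p.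
     \<exists>q\<subseteq>T. is_tree q \<and> p \<tturnstile> f_branch \<tau> q \<and> (\<forall>x\<in>branches q. f x n = m)}"

text \<open>\<open>f_value_in \<upsilon> n B\<close> says that the value at \<open>n\<close> of the function named by \<open>\<upsilon>\<close> lies in \<open>B\<close>.\<close>

definition f_value_in :: "(nat \<times> nat) name \<Rightarrow> nat \<Rightarrow> nat set \<Rightarrow> stmt" where
  "f_value_in \<upsilon> n B = f_ex B (\<lambda>m. f_mem (n, m) \<upsilon>)"

section \<open>Baire measurable and continuous functions\<close>

definition nowhere_dense_in :: "'a topology \<Rightarrow> 'a set \<Rightarrow> bool" where
  "nowhere_dense_in X A \<longleftrightarrow> A \<subseteq> topspace X \<and> X interior_of (X closure_of A) = {}"

definition meager_in :: "'a topology \<Rightarrow> 'a set \<Rightarrow> bool" where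
  "meager_in X A \<longleftrightarrow> (\<exists>N :: nat \<Rightarrow> 'a set. (\<forall>k. nowhere_dense_in X (N k)) \<and> A = (\<Union>k. N k))"

definition baire_property_in :: "'a topology \<Rightarrow> 'a set \<Rightarrow> bool" where
  "baire_property_in X A \<longleftrightarrow>
     A \<subseteq> topspace X \<and> (\<exists>U. openin X U \<and> meager_in X ((A - U) \<union> (U - A)))"

text \<open>The Baire property is required in the restricted sense of Kuratowski, that is, relative to
  every subspace. All Borel functions are included. With the Baire property relative to \<open>[T]\<close> only,
  \<open>f\<close> could be completely arbitrary on \<open>[S]\<close> for a splitting tree \<open>S \<subseteq> T\<close> with \<open>[S]\<close> nowhere dense in
  \<open>[T]\<close>, and \<open>f(x_gen)\<close> would have no meaning below \<open>S\<close>.\<close>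

definition baire_measurable_on ::
    "'a::topological_space set \<Rightarrow> ('a \<Rightarrow> 'b::topological_space) \<Rightarrow> bool" where
  "baire_measurable_on A f \<longleftrightarrow>
     (\<forall>E\<subseteq>A. \<forall>U. open U \<longrightarrow> baire_property_in (top_of_set E) (E \<inter> f -` U))"

section \<open>The weak Sacks property\<close>

definition wsacks :: "(point \<Rightarrow> nat \<Rightarrow> nat) set \<Rightarrow> tree \<Rightarrow> bool" where
  "wsacks \<Gamma> T \<longleftrightarrow>
     (\<forall>g :: nat \<Rightarrow> nat. \<forall>f\<in>\<Gamma>. filterlim g at_top sequentially \<longrightarrow>
        (\<exists>S a H. splitting_tree S \<and> S \<subseteq> T \<and> infinite a \<and>
           (\<forall>n\<in>a. finite (H n) \<and> card (H n) = g n) \<and>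
           S \<tturnstile> f_all a (\<lambda>n. f_value_in (value_name T f x_gen) n (H n))))"

definition wsacks_baire :: "tree \<Rightarrow> bool" where
  "wsacks_baire T \<longleftrightarrow> wsacks {f. baire_measurable_on (branches T) f} T"

definition wsacks_cont :: "tree \<Rightarrow> bool" where
  "wsacks_cont T \<longleftrightarrow> wsacks {f. continuous_on (branches T) f} T"

end

theory Submission
  imports Defs
begin

text \<open>If every \<open>S \<restriction> s\<close> is finitely covering, a fusion inside \<open>S\<close> along finite covers produces a splitting
  tree whose branches avoid a given meager set and of which finitely many nodes, boundedly many
  before \<open>n\<close> is chosen, decide \<open>f(x)(n)\<close>.

  Conversely, let \<open>T\<close> have no subtree as in (3). A Cantor-Bendixson analysis gives countably many
  trees \<open>D\<^sub>i\<close>, none of them finitely covered, such that every splitting \<open>S \<subseteq> T\<close> has some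
  \<open>S \<restriction> s\<close> inside some \<open>D\<^sub>i\<close>. By compactness there is \<open>b(n)\<close> such that \<open>n\<close> branches of \<open>D\<^sub>i\<close>,
  \<open>i \<le> n\<close>, never cover \<open>[n, b(n))\<close>. If \<open>f(x)(n)\<close> codes \<open>x \<restriction> b(n)\<close> and only \<open>n\<close> values are allowed at
  \<open>n\<close>, then \<open>S \<restriction> s\<close> looks like \<open>n\<close> branches up to \<open>b(n)\<close> for infinitely many \<open>n\<close>, so it is not
  splitting.\<close>

section \<open>Covering, restricted trees and initial segments\<close>

lemma covers_cofinite_iff:
  "covers_cofinite X \<longleftrightarrow> (\<exists>N. \<forall>n\<ge>N. \<forall>i. \<exists>s\<in>X. s n = Some i)"
proof
  assume "covers_cofinite X"
  then obtain a where a: "finite (- a)" "covers X a"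
    unfolding covers_cofinite_def by blast
  then obtain N where "\<forall>n\<in>- a. n < N"
    using finite_nat_set_iff_bounded by blast
  then have "\<forall>n\<ge>N. n \<in> a" by (metis ComplI not_less)
  then show "\<exists>N. \<forall>n\<ge>N. \<forall>i. \<exists>s\<in>X. s n = Some i"
    using a(2) unfolding covers_def by blast
next
  assume "\<exists>N. \<forall>n\<ge>N. \<forall>i. \<exists>s\<in>X. s n = Some i"
  then obtain N where "\<forall>n\<ge>N. \<forall>i. \<exists>s\<in>X. s n = Some i" by blast
  moreover have "finite (- {N..})" by (simp add: Compl_atLeast)
  ultimately show "covers_cofinite X"
    unfolding covers_cofinite_def covers_def by (intro exI[of _ "{N..}"]) auto
qed

lemma covers_cofinite_fin_seq_iff:
  "covers_cofinite (fin_seq ` A) \<longleftrightarrow> (\<exists>N. \<forall>n\<ge>N. \<forall>i. \<exists>s\<in>A. n < length s \<and> s ! n = i)"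
proof -
  have "fin_seq s n = Some i \<longleftrightarrow> n < length s \<and> s ! n = i" for s n i
    by (auto simp: fin_seq_def)
  then show ?thesis unfolding covers_cofinite_iff by simp
qed

lemma covers_cofinite_inf_seq_iff:
  "covers_cofinite (inf_seq ` X) \<longleftrightarrow> (\<exists>N. \<forall>n\<ge>N. \<forall>i. \<exists>x\<in>X. x n = i)"
  unfolding covers_cofinite_iff by (simp add: inf_seq_def)

lemma is_treeD: "is_tree T \<Longrightarrow> t \<in> T \<Longrightarrow> prefix s t \<Longrightarrow> s \<in> T"
  unfolding is_tree_def by blast

lemma splitting_tree_is_tree: "splitting_tree T \<Longrightarrow> is_tree T"
  unfolding splitting_tree_def by blast

lemma splitting_tree_covers:
  assumes "splitting_tree T" "t \<in> T"
  obtains N where "\<And>n i. n \<ge> N \<Longrightarrow> \<exists>s\<in>restrict_tree T t. n < length s \<and> s ! n = i"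
  using assms unfolding splitting_tree_def covers_cofinite_fin_seq_iff by metis

lemma restrict_tree_subset: "restrict_tree T t \<subseteq> T"
  unfolding restrict_tree_def by blast

lemma restrict_tree_mono: "S \<subseteq> T \<Longrightarrow> restrict_tree S t \<subseteq> restrict_tree T t"
  unfolding restrict_tree_def by blast

lemma self_in_restrict_tree: "t \<in> T \<Longrightarrow> t \<in> restrict_tree T t"
  unfolding restrict_tree_def by simp

lemma splitting_restrict_tree:
  assumes "splitting_tree T" "t \<in> T"
  shows "splitting_tree (restrict_tree T t)"
  unfolding splitting_tree_def
proof (intro conjI ballI)
  show "is_tree (restrict_tree T t)"
    using splitting_tree_is_tree[OF assms(1)] prefix_order.trans prefix_same_cases
    unfolding is_tree_def restrict_tree_def by blast
  show "restrict_tree T t \<noteq> {}"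
    using self_in_restrict_tree[OF assms(2)] by blast
  fix s assume s: "s \<in> restrict_tree T t"
  \<comment> \<open>The longer of two comparable nodes. It extends both, so a string comparable with
    \<open>u\<close> is comparable with \<open>s\<close> and with \<open>t\<close>.\<close>
  define u where "u = (if prefix s t then t else s)"
  have u: "u \<in> T" "prefix t u" "prefix s u"
    using s assms(2) by (auto simp: u_def restrict_tree_def)
  have "restrict_tree T u \<subseteq> restrict_tree (restrict_tree T t) s"
    using u(2,3) prefix_order.trans prefix_same_cases unfolding restrict_tree_def by blast
  moreover obtain N where "\<And>n i. n \<ge> N \<Longrightarrow> \<exists>v\<in>restrict_tree T u. n < length v \<and> v ! n = i"
    using splitting_tree_covers[OF assms(1) u(1)] by blast
  ultimately show "covers_cofinite (fin_seq ` restrict_tree (restrict_tree T t) s)"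
    unfolding covers_cofinite_fin_seq_iff by blast
qed

lemma prefix_map_upt: "j \<le> k \<Longrightarrow> prefix (map x [0..<j]) (map x [0..<k])"
  by (metis le_add_diff_inverse map_append prefixI upt_add_eq_append zero_le)

lemma prefix_nth: "prefix s t \<Longrightarrow> i < length s \<Longrightarrow> s ! i = t ! i"
  by (auto simp: prefix_def nth_append)

lemma prefix_map_upt_iff:
  "prefix t (map x [0..<k]) \<longleftrightarrow> length t \<le> k \<and> map x [0..<length t] = t"
proof
  assume a: "prefix t (map x [0..<k])"
  then have "length t \<le> k" using prefix_length_le by fastforce
  moreover have "map x [0..<length t] = t"
    using prefix_nth[OF a] \<open>length t \<le> k\<close> by (intro nth_equalityI) auto
  ultimately show "length t \<le> k \<and> map x [0..<length t] = t" by blast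
next
  assume "length t \<le> k \<and> map x [0..<length t] = t"
  then show "prefix t (map x [0..<k])" using prefix_map_upt by metis
qed

lemma prefix_of_restrict_tree:
  assumes "s \<in> restrict_tree T t" "length t \<le> length s"
  shows "prefix t s"
proof -
  consider "prefix s t" | "prefix t s" using assms(1) unfolding restrict_tree_def by blast
  then show ?thesis
  proof cases
    case 1
    then show ?thesis using prefix_length_prefix[of t t s] assms(2) by simp
  qed
qed

lemma nth_eq_of_restrict_tree:
  assumes "s \<in> restrict_tree T t" "i < length s" "i < length t"
  shows "s ! i = t ! i"
  using assms prefix_nth unfolding restrict_tree_def by fastforce

lemma branches_mono: "S \<subseteq> T \<Longrightarrow> branches S \<subseteq> branches T"
  unfolding branches_def by blast

lemma branches_restrict_tree_iff:
  "x \<in> branches (restrict_tree T t) \<longleftrightarrow> x \<in> branches T \<and> map x [0..<length t] = t"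
proof
  assume a: "x \<in> branches (restrict_tree T t)"
  then have "map x [0..<length t] \<in> restrict_tree T t" unfolding branches_def by blast
  then have "map x [0..<length t] = t"
    using prefix_of_restrict_tree[of "map x [0..<length t]" T t] by (simp add: prefix_map_upt_iff)
  then show "x \<in> branches T \<and> map x [0..<length t] = t"
    using a branches_mono[OF restrict_tree_subset] by blast
next
  assume a: "x \<in> branches T \<and> map x [0..<length t] = t"
  have "map x [0..<k] \<in> restrict_tree T t" for k
  proof (cases "k \<le> length t")
    case True
    then have "prefix (map x [0..<k]) t" using prefix_map_upt a by metis
    then show ?thesis using a unfolding restrict_tree_def branches_def by blast
  next
    case False
    then have "prefix t (map x [0..<k])" using a by (simp add: prefix_map_upt_iff)
    then show ?thesis using a unfolding restrict_tree_def branches_def by blast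
  qed
  then show "x \<in> branches (restrict_tree T t)" unfolding branches_def by blast
qed

lemma branches_restrict_tree_antimono:
  assumes "prefix s t"
  shows "branches (restrict_tree T t) \<subseteq> branches (restrict_tree T s)"
proof
  fix x assume "x \<in> branches (restrict_tree T t)"
  then have "x \<in> branches T" "map x [0..<length t] = t" by (auto simp: branches_restrict_tree_iff)
  then show "x \<in> branches (restrict_tree T s)"
    using assms prefix_map_upt_iff[of s x "length t"] by (simp add: branches_restrict_tree_iff)
qed

section \<open>Branches as limits of chains of nodes\<close>

lemma branch_of_chain:
  fixes t :: "nat \<Rightarrow> bool list"
  assumes "is_tree T" "\<And>k. t k \<in> T" "\<And>k. prefix (t k) (t (Suc k))" "\<And>k. k \<le> length (t k)"
  obtains x where "x \<in> branches T" "\<And>k. map x [0..<length (t k)] = t k"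
proof -
  have mono: "prefix (t j) (t k)" if "j \<le> k" for j k
    using that by (induction rule: dec_induct) (use assms(3) prefix_order.trans in blast)+
  \<comment> \<open>\<open>t (Suc i)\<close> has length at least \<open>Suc i\<close>, so its entry
    at \<open>i\<close> exists, and the chain makes all members of length above \<open>i\<close>
    agree there.\<close>
  define x where "x i = t (Suc i) ! i" for i
  have nth: "t k ! i = x i" if "i < length (t k)" for i k
  proof (cases "k \<le> Suc i")
    case True
    then show ?thesis using prefix_nth[OF mono[OF True] that] by (simp add: x_def)
  next
    case False
    moreover have "i < length (t (Suc i))" using assms(4)[of "Suc i"] by simp
    ultimately show ?thesis using prefix_nth[OF mono[of "Suc i" k]] by (simp add: x_def)
  qed
  have eq: "map x [0..<length (t k)] = t k" for k
    by (intro nth_equalityI) (auto simp: nth)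
  moreover have "map x [0..<k] \<in> T" for k
    using is_treeD[OF assms(1,2)] prefix_map_upt[OF assms(4)] eq by metis
  ultimately show ?thesis using that unfolding branches_def by blast
qed

lemma splitting_tree_extend:
  assumes "splitting_tree T" "t \<in> T"
  obtains s where "s \<in> T" "prefix t s" "length s = max k (length t)"
proof -
  obtain N where N: "\<And>n i. n \<ge> N \<Longrightarrow> \<exists>s\<in>restrict_tree T t. n < length s \<and> s ! n = i"
    using splitting_tree_covers[OF assms] by blast
  obtain u where u: "u \<in> restrict_tree T t" "max N (max k (length t)) < length u"
    using N[of "max N (max k (length t))" True] by auto
  have pu: "prefix t u"
    using u prefix_length_le[of u t] by (auto simp: restrict_tree_def)
  define s where "s = take (max k (length t)) u"
  have "prefix s u" by (simp add: s_def take_is_prefix)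
  then have "s \<in> T" using is_treeD[OF splitting_tree_is_tree[OF assms(1)]] u(1)
    by (auto simp: restrict_tree_def)
  moreover have len: "length s = max k (length t)" using u(2) by (simp add: s_def)
  moreover have "prefix t s" using prefix_length_prefix[OF pu \<open>prefix s u\<close>] len by simp
  ultimately show ?thesis using that by blast
qed

lemma splitting_tree_branch:
  assumes "splitting_tree T" "t \<in> T"
  obtains x where "x \<in> branches T" "map x [0..<length t] = t"
proof -
  have "\<exists>s. \<forall>k. (s k \<in> T \<and> k \<le> length (s k) \<and> (k = 0 \<longrightarrow> s k = t)) \<and> prefix (s k) (s (Suc k))"
  proof (rule dependent_nat_choice)
    show "\<exists>x. x \<in> T \<and> 0 \<le> length x \<and> (0 = (0::nat) \<longrightarrow> x = t)" using assms by blast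
    fix x :: "bool list" and k :: nat
    assume "x \<in> T \<and> k \<le> length x \<and> (k = 0 \<longrightarrow> x = t)"
    then show "\<exists>y. (y \<in> T \<and> Suc k \<le> length y \<and> (Suc k = 0 \<longrightarrow> y = t)) \<and> prefix x y"
      using splitting_tree_extend[OF assms(1), of x "Suc k"] by (metis max.cobounded1 nat.simps(3))
  qed
  then obtain s where s: "\<And>k. s k \<in> T" "\<And>k. k \<le> length (s k)" "s 0 = t"
    "\<And>k. prefix (s k) (s (Suc k))" by metis
  obtain x where "x \<in> branches T" "\<And>k. map x [0..<length (s k)] = s k"
    using branch_of_chain[OF splitting_tree_is_tree[OF assms(1)] s(1,4,2)] by blast
  then show ?thesis using that s(3) by metis
qed

section \<open>The generic branch\<close>

text \<open>The \<open>ARG_MAX\<close> in \<open>stem\<close> is meaningful because the candidates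
  have bounded length: covering yields a position \<open>N\<close> where two nodes of
  \<open>p\<close> differ, and a node longer than \<open>N\<close> cannot be comparable with both of
  them.\<close>

lemma
  assumes "splitting_tree p"
  shows restrict_tree_stem: "restrict_tree p (stem p) = p"
    and length_stem_ge: "\<And>t. t \<in> p \<Longrightarrow> restrict_tree p t = p \<Longrightarrow> length t \<le> length (stem p)"
    and stem_in: "stem p \<in> p"
proof -
  let ?P = "\<lambda>t. t \<in> p \<and> restrict_tree p t = p"
  obtain t0 where "t0 \<in> p" using assms unfolding splitting_tree_def by blast
  then have nil: "[] \<in> p" using is_treeD[OF splitting_tree_is_tree[OF assms]] by fastforce
  then have P0: "?P []" unfolding restrict_tree_def by auto
  obtain N where N: "\<And>n i. n \<ge> N \<Longrightarrow> \<exists>s\<in>restrict_tree p []. n < length s \<and> s ! n = i"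
    using splitting_tree_covers[OF assms nil] by blast
  obtain u v where uv: "u \<in> p" "v \<in> p" "N < length u" "N < length v" "u ! N" "\<not> v ! N"
    using N[of N True] N[of N False] by (auto simp: restrict_tree_def)
  have "length t < Suc N" if "?P t" for t
  proof (rule ccontr)
    assume "\<not> length t < Suc N"
    then have N: "N < length t" by simp
    have "w ! N = t ! N" if w: "w \<in> p" "N < length w" for w
    proof -
      have "w \<in> restrict_tree p t" using \<open>?P t\<close> w by simp
      then show ?thesis using w N nth_eq_of_restrict_tree by blast
    qed
    then show False using uv by blast
  qed
  then have bd: "\<forall>t. ?P t \<longrightarrow> length t < Suc N" by blast
  have *: "?P (stem p) \<and> (\<forall>t. ?P t \<longrightarrow> length t \<le> length (stem p))"
    unfolding stem_def by (rule arg_max_nat_lemma[of ?P, OF P0 bd])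
  show "restrict_tree p (stem p) = p" "stem p \<in> p" using * by auto
  show "\<And>t. t \<in> p \<Longrightarrow> restrict_tree p t = p \<Longrightarrow> length t \<le> length (stem p)" using * by blast
qed

text \<open>Given \<open>q\<close> below \<open>p\<close>, restrict it to a node \<open>t\<close> of
  length \<open>k\<close>. Every condition below this restriction has a stem that extends
  \<open>t\<close>, and so it decides the first \<open>k\<close> values of the generic real as in
  \<open>t\<close>.\<close>

lemma forces_f_branch_self:
  assumes "splitting_tree p"
  shows "p \<tturnstile> f_branch x_gen p"
proof -
  have "dense_below p (\<lambda>r. \<exists>t\<in>{t \<in> p. length t = k}. f_all {..<k} (\<lambda>i. f_mem (i, t ! i) x_gen) r)" for k
    unfolding dense_below_def
  proof (intro allI impI)
    fix q assume q: "splitting_tree q \<and> q \<subseteq> p"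
    then have "[] \<in> q"
      unfolding splitting_tree_def is_tree_def by (meson Nil_prefix all_not_in_conv)
    then obtain t where t: "t \<in> q" "length t = k"
      using splitting_tree_extend[of q "[]" k] q by auto
    have "f_mem (i, t ! i) x_gen (restrict_tree q t)" if "i < k" for i
      unfolding f_mem_def dense_below_def
    proof (intro allI impI)
      fix r assume r: "splitting_tree r \<and> r \<subseteq> restrict_tree q t"
      obtain t' where "t' \<in> r" using r unfolding splitting_tree_def by blast
      then obtain s where s: "s \<in> r" "k \<le> length s"
        using splitting_tree_extend[of r t' k] r by (metis max.cobounded1)
      \<comment> \<open>A long node of \<open>r\<close> passes through \<open>t\<close>, so
        \<open>t\<close> is itself a node of \<open>r\<close> comparable with all others and
        competes for the stem.\<close>
      then have "prefix t s"
        using prefix_of_restrict_tree r t(2) by blast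
      then have tr: "t \<in> r" using is_treeD[OF splitting_tree_is_tree] r s by blast
      have eq: "restrict_tree r t = r" using r unfolding restrict_tree_def by blast
      have len: "k \<le> length (stem r)" using length_stem_ge[OF _ tr eq] r t by simp
      have "stem r \<in> restrict_tree r t" using stem_in r eq by blast
      then have "stem r ! i = t ! i"
        using nth_eq_of_restrict_tree that len t(2) by simp
      then have "((i, t ! i), r) \<in> x_gen" using r len that unfolding x_gen_def by auto
      then show "\<exists>r'. splitting_tree r' \<and> r' \<subseteq> r \<and> (\<exists>s. ((i, t ! i), s) \<in> x_gen \<and> r' \<subseteq> s)"
        using r by blast
    qed
    then show "\<exists>r. splitting_tree r \<and> r \<subseteq> q \<and>
        (\<exists>t\<in>{t \<in> p. length t = k}. f_all {..<k} (\<lambda>i. f_mem (i, t ! i) x_gen) r)"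
      using t q splitting_restrict_tree[of q t] restrict_tree_subset[of q t]
      unfolding f_all_def by blast
  qed
  then show ?thesis using assms unfolding forces_def f_branch_def f_all_def f_ex_def by blast
qed

text \<open>Below the restriction of \<open>p\<close> to its node \<open>t\<close> the generic real
  begins with \<open>t\<close>. Some condition there also forces it to begin with a node
  \<open>t'\<close> of \<open>q\<close> of the same length, hence \<open>t = t'\<close>.\<close>

lemma forces_f_branch_subset:
  assumes "p \<tturnstile> f_branch x_gen q"
  shows "p \<subseteq> q"
proof
  fix t assume t: "t \<in> p"
  have p: "splitting_tree p" using assms unfolding forces_def by blast
  have sp: "splitting_tree (restrict_tree p t)" by (rule splitting_restrict_tree[OF p t])
  have "dense_below p (\<lambda>r. \<exists>t'\<in>{t' \<in> q. length t' = length t}.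
      f_all {..<length t} (\<lambda>i. f_mem (i, t' ! i) x_gen) r)"
    using assms unfolding forces_def f_branch_def f_all_def f_ex_def by blast
  then obtain r t' where r: "splitting_tree r" "r \<subseteq> restrict_tree p t"
    and t': "t' \<in> q" "length t' = length t"
    and mem: "\<And>i. i < length t \<Longrightarrow> f_mem (i, t' ! i) x_gen r"
    using that sp restrict_tree_subset[of p t] unfolding dense_below_def f_all_def Ball_def lessThan_iff
    by blast
  have "t ! i = t' ! i" if i: "i < length t" for i
  proof -
    obtain r' s where r': "splitting_tree r'" "r' \<subseteq> r" "((i, t' ! i), s) \<in> x_gen" "r' \<subseteq> s"
      using mem[OF i] r(1) unfolding f_mem_def dense_below_def by blast
    then have s: "splitting_tree s" "i < length (stem s)" "stem s ! i = t' ! i"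
      unfolding x_gen_def by auto
    obtain u0 where "u0 \<in> r'" using r'(1) unfolding splitting_tree_def by blast
    \<comment> \<open>A long node of \<open>r'\<close> lies in both restrictions, so its entry at
      \<open>i\<close> agrees with \<open>t\<close> and with the stem of \<open>s\<close>.\<close>
    then obtain u where u: "u \<in> r'" "length t \<le> length u"
      using splitting_tree_extend[OF r'(1), of u0 "length t"] by (metis max.cobounded1)
    have "u \<in> restrict_tree p t" using u r r' by blast
    then have "u ! i = t ! i"
      using nth_eq_of_restrict_tree i u(2) by simp
    moreover have "u \<in> restrict_tree s (stem s)" using u r' restrict_tree_stem[OF s(1)] by blast
    then have "u ! i = stem s ! i"
      using nth_eq_of_restrict_tree i u(2) s(2) by simp
    ultimately show ?thesis using s(3) by simp
  qed
  then have "t = t'" using t'(2) by (intro nth_equalityI) auto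
  then show "t \<in> q" using t'(1) by simp
qed

section \<open>Topology of the space of reals\<close>

lemma open_cylinder: "open {y :: point. map y [0..<k] = t}"
proof -
  have "open {y :: point. y i = c}" for i c
    using open_vimage[OF open_discrete[of "{c}"] continuous_on_product_coordinates[of i]]
    by (simp add: vimage_def)
  then have "open (\<Inter>i\<in>{..<k}. {y :: point. y i = t ! i})" by (intro open_INT) auto
  moreover have "{y :: point. map y [0..<k] = t} =
      (if length t = k then \<Inter>i\<in>{..<k}. {y. y i = t ! i} else {})"
    by (auto simp: list_eq_iff_nth_eq)
  ultimately show ?thesis by simp
qed

lemma cylinder_subset_open:
  fixes x :: point
  assumes "open U" "x \<in> U"
  obtains k where "{y. map y [0..<k] = map x [0..<k]} \<subseteq> U"
proof -
  have "openin (product_topology (\<lambda>i::nat. euclidean :: bool topology) UNIV) U"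
    using assms(1) by (simp add: euclidean_product_topology)
  then obtain B where B: "x \<in> Pi\<^sub>E UNIV B" "finite {i. B i \<noteq> topspace (euclidean :: bool topology)}"
    "Pi\<^sub>E UNIV B \<subseteq> U"
    using product_topology_open_contains_basis[OF _ assms(2)] by blast
  then obtain k where k: "\<forall>i\<in>{i. B i \<noteq> UNIV}. i < k"
    using finite_nat_set_iff_bounded by auto
  have "{y. map y [0..<k] = map x [0..<k]} \<subseteq> Pi\<^sub>E UNIV B"
  proof clarify
    fix y assume "map y [0..<k] = map x [0..<k]"
    then have "y i = x i" if "i < k" for i using that by simp
    then have "y i \<in> B i" for i using PiE_mem[OF B(1), of i] k by (cases "i < k") auto
    then show "y \<in> Pi\<^sub>E UNIV B" by auto
  qed
  then show ?thesis using that B(3) by blast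
qed

lemma baire_measurable_on_continuous:
  assumes "continuous_on A f"
  shows "baire_measurable_on A f"
  unfolding baire_measurable_on_def
proof (intro allI impI)
  fix E U
  assume E: "E \<subseteq> A" and U: "open (U :: 'b set)"
  have "openin (top_of_set E) (E \<inter> f -` U)"
    using continuous_on_subset[OF assms E] U by (rule continuous_openin_preimage_gen)
  moreover have "meager_in (top_of_set E) {}"
    unfolding meager_in_def nowhere_dense_in_def by (intro exI[of _ "\<lambda>_. {}"]) simp
  ultimately show "baire_property_in (top_of_set E) (E \<inter> f -` U)"
    unfolding baire_property_in_def by (intro conjI exI[of _ "E \<inter> f -` U"]) auto
qed

text \<open>Each coordinate depends on a finite part of \<open>x\<close> only, so it is locally
  constant.\<close>

lemma continuous_on_initial_segments:
  fixes h :: "nat \<Rightarrow> bool list \<Rightarrow> 'a :: topological_space"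
  shows "continuous_on A (\<lambda>x::point. \<lambda>n. h n (map x [0..<b n]))"
proof (intro continuous_on_coordinatewise_then_product)
  fix n
  have "open ((\<lambda>x::point. h n (map x [0..<b n])) -` U)" for U
  proof -
    have "(\<lambda>x::point. h n (map x [0..<b n])) -` U = (\<Union>t\<in>h n -` U. {x. map x [0..<b n] = t})"
      by auto
    then show ?thesis using open_cylinder by auto
  qed
  then have "continuous_on UNIV (\<lambda>x::point. h n (map x [0..<b n]))"
    by (simp add: continuous_on_open_vimage)
  then show "continuous_on A (\<lambda>x::point. h n (map x [0..<b n]))"
    using continuous_on_subset by blast
qed

text \<open>Sequential compactness of Cantor space, by Koenig's lemma: a string matched by
  infinitely many \<open>y b\<close> has a one-bit extension that is still matched by infinitely
  many.\<close>

lemma cluster_point: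
  fixes y :: "nat \<Rightarrow> nat \<Rightarrow> bool"
  obtains z where "\<And>k. infinite {b. \<forall>i<k. y b i = z i}"
proof -
  let ?I = "\<lambda>t. infinite {b. \<forall>i<length t. y b i = t ! i}"
  have "\<exists>s. \<forall>k. (length (s k) = k \<and> ?I (s k)) \<and> prefix (s k) (s (Suc k))"
  proof (rule dependent_nat_choice)
    show "\<exists>x :: bool list. length x = 0 \<and> ?I x" by simp
    fix t :: "bool list" and k :: nat
    assume t: "length t = k \<and> ?I t"
    have "{b. \<forall>i<length t. y b i = t ! i} =
       (\<Union>c. {b. \<forall>i<length (t @ [c]). y b i = (t @ [c]) ! i})"
      by (auto simp: nth_append less_Suc_eq)
    then obtain c where "?I (t @ [c])" using t by (metis (no_types, lifting) finite_UN finite_class.finite_UNIV)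
    then show "\<exists>u. (length u = Suc k \<and> ?I u) \<and> prefix t u" using t by (intro exI[of _ "t @ [c]"]) auto
  qed
  then obtain s where "\<forall>k. (length (s k) = k \<and> ?I (s k)) \<and> prefix (s k) (s (Suc k))" ..
  then have s: "\<And>k. length (s k) = k" "\<And>k. ?I (s k)" "\<And>k. prefix (s k) (s (Suc k))"
    by blast+
  obtain z where z: "\<And>k. map z [0..<length (s k)] = s k"
    using branch_of_chain[of UNIV s] s unfolding is_tree_def by (metis UNIV_I order_refl)
  have "s k ! i = z i" if "i < k" for k i
    using z[of k] s(1)[of k] that by (metis add.left_neutral nth_map_upt diff_zero)
  then have "infinite {b. \<forall>i<k. y b i = z i}" for k using s(2)[of k] by (simp add: s(1) cong: conj_cong)
  then show ?thesis using that by blast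
qed

section \<open>Finite covers\<close>

text \<open>Unlike \<open>finitely_covering\<close>, this speaks of arbitrary sets of nodes: what is
  left of a tree after deleting some nodes need not be splitting.\<close>

definition fin_cov :: "tree \<Rightarrow> bool" where
  "fin_cov D \<longleftrightarrow> (\<exists>X\<subseteq>branches D. finite X \<and> covers_cofinite (inf_seq ` X))"

lemma fin_cov_mono: "fin_cov D \<Longrightarrow> D \<subseteq> E \<Longrightarrow> fin_cov E"
  unfolding fin_cov_def by (meson branches_mono order_trans)

lemma finitely_covering_iff: "finitely_covering S \<longleftrightarrow> splitting_tree S \<and> fin_cov S"
  unfolding finitely_covering_def fin_cov_def by blast

text \<open>Compactness: if for every \<open>b\<close> some \<open>k\<close> branches covered the
  interval from \<open>n\<close> to \<open>b\<close>, a cluster point of these tuples would consist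
  of \<open>k\<close> branches that cover everything from \<open>n\<close> on.\<close>

lemma uncovered_interval:
  assumes "\<not> fin_cov D"
  shows "\<exists>b. \<forall>x :: nat \<Rightarrow> point. (\<forall>j<k. x j \<in> branches D) \<longrightarrow>
    (\<exists>i\<in>{n..<b}. \<exists>c. \<forall>j<k. x j i \<noteq> c)"
proof (rule ccontr)
  assume "\<not> ?thesis"
  then have "\<forall>b. \<exists>x :: nat \<Rightarrow> point. (\<forall>j<k. x j \<in> branches D) \<and>
      (\<forall>i\<in>{n..<b}. \<forall>c. \<exists>j<k. x j i = c)"
    by simp
  from choice[OF this] obtain x :: "nat \<Rightarrow> nat \<Rightarrow> point" where
    "\<forall>b. (\<forall>j<k. x b j \<in> branches D) \<and> (\<forall>i\<in>{n..<b}. \<forall>c. \<exists>j<k. x b j i = c)" ..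
  then have x: "\<And>b j. j < k \<Longrightarrow> x b j \<in> branches D"
    "\<And>b i c. n \<le> i \<Longrightarrow> i < b \<Longrightarrow> \<exists>j<k. x b j i = c"
    by simp_all
  \<comment> \<open>A sequence of reals is coded as a single real by pairing, so that one cluster
    point serves all \<open>k\<close> coordinates at once.\<close>
  obtain z where z: "\<And>m. infinite {b. \<forall>e<m. x b (fst (prod_decode e)) (snd (prod_decode e)) = z e}"
    using cluster_point[of "\<lambda>b e. x b (fst (prod_decode e)) (snd (prod_decode e))"] by blast
  define w where "w j i = z (prod_encode (j, i))" for j i
  \<comment> \<open>Having \<open>b\<close> above \<open>m\<close> matters: the positions on which
    the tuples agree then lie in the interval covered by the \<open>b\<close>-th tuple.\<close>
  have agree: "\<exists>b>m. \<forall>j<k. \<forall>i<m. x b j i = w j i" for m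
  proof -
    have "finite (prod_encode ` ({..<k} \<times> {..<m}))" by blast
    then obtain M where M: "\<forall>e\<in>prod_encode ` ({..<k} \<times> {..<m}). e < M"
      using finite_nat_set_iff_bounded by blast
    obtain b where "b > m" "\<forall>e<M. x b (fst (prod_decode e)) (snd (prod_decode e)) = z e"
      using z[of M] unfolding infinite_nat_iff_unbounded by blast
    moreover have "prod_encode (j, i) < M" if "j < k" "i < m" for j i using M that by blast
    ultimately show ?thesis unfolding w_def by (metis fst_conv prod_encode_inverse snd_conv)
  qed
  have wD: "w j \<in> branches D" if j: "j < k" for j
    unfolding branches_def
  proof clarify
    fix m
    obtain b where "\<forall>i<m. x b j i = w j i" using agree[of m] j by blast
    then have eq: "map (w j) [0..<m] = map (x b j) [0..<m]" by simp
    have "map (x b j) [0..<m] \<in> D" using x(1)[OF j] unfolding branches_def by blast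
    then show "map (w j) [0..<m] \<in> D" by (simp only: eq)
  qed
  have "\<exists>j<k. w j i = c" if "n \<le> i" for i c
  proof -
    obtain b where b: "b > Suc i" "\<forall>j<k. \<forall>i'<Suc i. x b j i' = w j i'" using agree[of "Suc i"] by blast
    then obtain j where "j < k" "x b j i = c" using x(2)[of i b c] b(1) \<open>n \<le> i\<close> by auto
    then show ?thesis using b(2) by auto
  qed
  then have "covers_cofinite (inf_seq ` w ` {..<k})"
    unfolding covers_cofinite_inf_seq_iff by (intro exI[of _ n]) auto
  moreover have "w ` {..<k} \<subseteq> branches D" using wD by blast
  ultimately show False using assms unfolding fin_cov_def by blast
qed

section \<open>From the weak Sacks property to finite covers\<close>

text \<open>This applies to what survives the derivative. A finite cover above \<open>t\<close> is
  also one above each initial segment of \<open>t\<close>, so \<open>C\<close> is a tree; initial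
  segments of the covering branches show that it is splitting.\<close>

lemma splitting_tree_if_locally_fin_cov:
  assumes "is_tree T" "C \<subseteq> T" "C \<noteq> {}" "\<And>s. s \<in> T \<Longrightarrow> s \<in> C \<longleftrightarrow> fin_cov (restrict_tree C s)"
  shows "splitting_tree C"
  unfolding splitting_tree_def
proof (intro conjI ballI)
  show "is_tree C" unfolding is_tree_def
  proof (intro ballI allI impI)
    fix s t assume st: "t \<in> C" "prefix s t"
    have "t \<in> T" using st(1) assms(2) by blast
    then have "fin_cov (restrict_tree C t)" using assms(4) st(1) by simp
    then have "fin_cov (restrict_tree C s)"
      using branches_restrict_tree_antimono[OF st(2)] unfolding fin_cov_def by (meson order_trans)
    moreover have "s \<in> T" using is_treeD[OF assms(1) \<open>t \<in> T\<close> st(2)] .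
    ultimately show "s \<in> C" using assms(4) by simp
  qed
  show "C \<noteq> {}" by fact
  fix t assume "t \<in> C"
  moreover have "t \<in> T" using \<open>t \<in> C\<close> assms(2) by blast
  ultimately have "fin_cov (restrict_tree C t)" using assms(4)[of t] by simp
  then obtain X where X: "X \<subseteq> branches (restrict_tree C t)" "covers_cofinite (inf_seq ` X)"
    unfolding fin_cov_def by blast
  obtain N where N: "\<forall>n\<ge>N. \<forall>i. \<exists>x\<in>X. x n = i"
    using X(2)[unfolded covers_cofinite_inf_seq_iff] ..
  have "\<exists>s\<in>restrict_tree C t. n < length s \<and> s ! n = i" if "n \<ge> N" for n i
  proof -
    have "\<exists>x\<in>X. x n = i" using N that by simp
    then obtain x where "x \<in> X" "x n = i" ..
    moreover have "map x [0..<Suc n] \<in> restrict_tree C t"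
      using X(1) \<open>x \<in> X\<close> unfolding branches_def by blast
    moreover have "n < length (map x [0..<Suc n])" "map x [0..<Suc n] ! n = x n"
      by (simp_all del: upt_Suc)
    ultimately show ?thesis by metis
  qed
  then show "covers_cofinite (fin_seq ` restrict_tree C t)"
    unfolding covers_cofinite_fin_seq_iff by blast
qed

text \<open>Iterating the derivative that deletes from the tree all nodes above which it is not finitely
  covered empties the tree. The least deleted level met by \<open>S\<close> supplies the member of the family.\<close>

lemma countable_non_fin_cov_family:
  assumes no: "\<And>S. splitting_tree S \<Longrightarrow> S \<subseteq> T \<Longrightarrow> \<exists>s\<in>S. \<not> fin_cov (restrict_tree S s)"
    and T: "splitting_tree T"
  obtains D :: "nat \<Rightarrow> tree" where "\<And>i. \<not> fin_cov (D i)"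
    "\<And>S. splitting_tree S \<Longrightarrow> S \<subseteq> T \<Longrightarrow> \<exists>s\<in>S. \<exists>i. restrict_tree S s \<subseteq> D i"
proof -
  \<comment> \<open>\<open>R\<close> holds the nodes deleted so far. Deleting more leaves fewer
    branches, so the operator is monotone and its least fixed point collects all nodes that are ever
    deleted.\<close>
  define \<Phi> where "\<Phi> R = {s. \<not> fin_cov (restrict_tree (T - R) s)}" for R
  have "mono \<Phi>"
  proof (intro monoI subsetI)
    fix R R' s assume "R \<le> R'" "s \<in> \<Phi> R"
    moreover from this(1) have "restrict_tree (T - R') s \<subseteq> restrict_tree (T - R) s"
      by (intro restrict_tree_mono) blast
    ultimately show "s \<in> \<Phi> R'" using fin_cov_mono unfolding \<Phi>_def mem_Collect_eq by metis
  qed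
  define hits where "hits \<D> S \<longleftrightarrow> (\<exists>s\<in>S. \<exists>D\<in>\<D>. restrict_tree S s \<subseteq> D)" for \<D> S
  have hits_mono: "hits \<D> S \<Longrightarrow> \<D> \<subseteq> \<D>' \<Longrightarrow> hits \<D>' S" for \<D> \<D>' S
    unfolding hits_def by blast
  define bad where "bad \<D> \<longleftrightarrow> countable \<D> \<and> (\<forall>D\<in>\<D>. \<not> fin_cov D)" for \<D>
  \<comment> \<open>The invariant of the transfinite induction: one countable family catches every
    splitting subtree that meets the deleted nodes.\<close>
  define good where "good R \<longleftrightarrow> (\<exists>\<D>. bad \<D> \<and>
      (\<forall>S. splitting_tree S \<longrightarrow> S \<subseteq> T \<longrightarrow> S \<inter> R \<noteq> {} \<longrightarrow> hits \<D> S))" for R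
  have "good (lfp \<Phi>)"
  proof (rule lfp_ordinal_induct[OF \<open>mono \<Phi>\<close>])
    fix R assume "good R"
    then obtain \<D> where \<D>: "bad \<D>"
      "\<And>S. splitting_tree S \<Longrightarrow> S \<subseteq> T \<Longrightarrow> S \<inter> R \<noteq> {} \<Longrightarrow> hits \<D> S"
      unfolding good_def by metis
    \<comment> \<open>One set is added for each newly deleted node, countably many in all. If
      \<open>S\<close> avoids \<open>R\<close> and contains a new node \<open>s\<close>, the part of
      \<open>S\<close> at \<open>s\<close> lies in the set added for \<open>s\<close>.\<close>
    define \<D>' where "\<D>' = \<D> \<union> restrict_tree (T - R) ` \<Phi> R"
    have "bad \<D>'" using \<D>(1) unfolding bad_def \<D>'_def \<Phi>_def by auto
    moreover have "hits \<D>' S"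
      if S: "splitting_tree S" "S \<subseteq> T" "S \<inter> \<Phi> R \<noteq> {}" for S
    proof (cases "S \<inter> R = {}")
      case True
      obtain s where s: "s \<in> S" "s \<in> \<Phi> R" using S(3) by blast
      moreover have "restrict_tree S s \<subseteq> restrict_tree (T - R) s"
        using S(2) True by (intro restrict_tree_mono) blast
      ultimately show ?thesis unfolding hits_def \<D>'_def by blast
    next
      case False
      then show ?thesis using hits_mono[OF \<D>(2)[OF S(1,2)]] unfolding \<D>'_def by simp
    qed
    ultimately show "good (\<Phi> R)" unfolding good_def by metis
  next
    fix M assume M: "\<forall>R\<in>M. good R"
    \<comment> \<open>At unions families are chosen per node, not per stage: \<open>M\<close> may be
      uncountable, but there are only countably many nodes.\<close>
    have "\<exists>\<D>. bad \<D> \<and> (\<forall>S. splitting_tree S \<longrightarrow> S \<subseteq> T \<longrightarrow> t \<in> S \<longrightarrow> hits \<D> S)"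
      if tM: "t \<in> \<Union>M" for t
    proof -
      obtain R where "t \<in> R" "good R" using M tM by blast
      then obtain \<D> where "bad \<D>"
        "\<And>S. splitting_tree S \<Longrightarrow> S \<subseteq> T \<Longrightarrow> S \<inter> R \<noteq> {} \<Longrightarrow> hits \<D> S"
        unfolding good_def by metis
      then show ?thesis using \<open>t \<in> R\<close> by blast
    qed
    then obtain \<D> where \<D>: "\<And>t. t \<in> \<Union>M \<Longrightarrow> bad (\<D> t)"
      "\<And>t S. t \<in> \<Union>M \<Longrightarrow> splitting_tree S \<Longrightarrow> S \<subseteq> T \<Longrightarrow> t \<in> S \<Longrightarrow> hits (\<D> t) S"
      by metis
    have "countable (\<Union>t\<in>\<Union>M. \<D> t)"
      by (rule countable_UN) (use \<D>(1) in \<open>auto simp: bad_def\<close>)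
    then have "bad (\<Union>t\<in>\<Union>M. \<D> t)" using \<D>(1) unfolding bad_def by blast
    moreover have "hits (\<Union>t\<in>\<Union>M. \<D> t) S"
      if S: "splitting_tree S" "S \<subseteq> T" "S \<inter> \<Union>M \<noteq> {}" for S
    proof -
      obtain t where t: "t \<in> S" "t \<in> \<Union>M" using S(3) by blast
      then have "\<D> t \<subseteq> (\<Union>t\<in>\<Union>M. \<D> t)" by blast
      then show ?thesis by (rule hits_mono[OF \<D>(2)[OF t(2) S(1,2) t(1)]])
    qed
    ultimately show "good (\<Union>M)" unfolding good_def by metis
  qed
  then obtain \<D> where \<D>: "countable \<D>" "\<And>D. D \<in> \<D> \<Longrightarrow> \<not> fin_cov D"
    "\<And>S. splitting_tree S \<Longrightarrow> S \<subseteq> T \<Longrightarrow> S \<inter> lfp \<Phi> \<noteq> {} \<Longrightarrow> hits \<D> S"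
    unfolding good_def bad_def by metis
  define C where "C = T - lfp \<Phi>"
  have eq: "s \<in> C \<longleftrightarrow> fin_cov (restrict_tree C s)" if "s \<in> T" for s
    using lfp_unfold[OF \<open>mono \<Phi>\<close>] that unfolding C_def \<Phi>_def by blast
  \<comment> \<open>A nonempty remainder would be a splitting subtree that is finitely covered above
    each of its nodes, against \<open>no\<close>.\<close>
  have "C = {}"
  proof (rule ccontr)
    assume "C \<noteq> {}"
    have sub: "C \<subseteq> T" unfolding C_def by blast
    have "splitting_tree C"
      by (rule splitting_tree_if_locally_fin_cov[OF splitting_tree_is_tree[OF T] sub \<open>C \<noteq> {}\<close> eq])
    then obtain s where "s \<in> C" "\<not> fin_cov (restrict_tree C s)" using no[OF _ sub] by blast
    then show False using eq[of s] sub by blast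
  qed
  then have "T \<subseteq> lfp \<Phi>" unfolding C_def by blast
  then have key: "hits \<D> S" if "splitting_tree S" "S \<subseteq> T" for S
    using \<D>(3)[OF that] that unfolding splitting_tree_def by blast
  \<comment> \<open>\<open>T\<close> itself is caught, so the family is nonempty and can be
    enumerated by the natural numbers.\<close>
  have "\<D> \<noteq> {}" using key[OF T] unfolding hits_def by blast
  then have ran: "range (from_nat_into \<D>) = \<D>" using \<D>(1) by (simp add: range_from_nat_into)
  show ?thesis
  proof (rule that)
    show "\<not> fin_cov (from_nat_into \<D> i)" for i using \<D>(2) ran by blast
    show "\<exists>s\<in>S. \<exists>i. restrict_tree S s \<subseteq> from_nat_into \<D> i" if "splitting_tree S" "S \<subseteq> T" for S
      using key[OF that] ran unfolding hits_def by (metis rangeE)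
  qed
qed

text \<open>Some condition below the restriction of \<open>S\<close> to \<open>t\<close> decides the
  value as an \<open>m'\<close> in \<open>H\<close>, through a tree \<open>q\<close> on which
  \<open>f\<close> has value \<open>m'\<close> at \<open>n\<close>. By
  \<open>forces_f_branch_subset\<close> its branches are branches of \<open>q\<close>; they also
  pass through \<open>t\<close>, so \<open>m' = m\<close>.\<close>

lemma forced_value:
  assumes S: "splitting_tree S" "S \<subseteq> T" and t: "t \<in> S"
    and const: "\<And>x. x \<in> branches T \<Longrightarrow> map x [0..<length t] = t \<Longrightarrow> f x n = m"
    and forced: "f_value_in (value_name T f x_gen) n H S"
  shows "m \<in> H"
proof -
  have St: "splitting_tree (restrict_tree S t)" by (rule splitting_restrict_tree[OF S(1) t])
  obtain r m' where r: "splitting_tree r" "r \<subseteq> restrict_tree S t" and "m' \<in> H"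
    and mem: "f_mem (n, m') (value_name T f x_gen) r"
    using forced[unfolded f_value_in_def f_ex_def dense_below_def, rule_format,
        OF conjI[OF St restrict_tree_subset]] by blast
  obtain r' p where r': "splitting_tree r'" "r' \<subseteq> r" "((n, m'), p) \<in> value_name T f x_gen" "r' \<subseteq> p"
    using mem[unfolded f_mem_def dense_below_def, rule_format, of r] r(1) by blast
  then obtain q where q: "p \<tturnstile> f_branch x_gen q" "\<forall>x\<in>branches q. f x n = m'"
    unfolding value_name_def by blast
  obtain u where "u \<in> r'" using r'(1) unfolding splitting_tree_def by blast
  then obtain x where x: "x \<in> branches r'" using splitting_tree_branch[OF r'(1)] by blast
  have "x \<in> branches q" using x branches_mono r'(4) forces_f_branch_subset[OF q(1)] by blast
  moreover have "x \<in> branches (restrict_tree S t)" using x branches_mono r'(2) r(2) by blast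
  then have "f x n = m" using const branches_mono[OF S(2)] by (auto simp: branches_restrict_tree_iff)
  ultimately show ?thesis using q(2) \<open>m' \<in> H\<close> by simp
qed

lemma subtree_if_wsacks_cont:
  assumes T: "splitting_tree T" and w: "wsacks_cont T"
  shows "\<exists>S. splitting_tree S \<and> S \<subseteq> T \<and> (\<forall>s\<in>S. finitely_covering (restrict_tree S s))"
proof (rule ccontr)
  assume neg: "\<not> ?thesis"
  have no: "\<exists>s\<in>S. \<not> fin_cov (restrict_tree S s)" if "splitting_tree S" "S \<subseteq> T" for S
    using neg that splitting_restrict_tree[OF that(1)] by (metis finitely_covering_iff)
  obtain D :: "nat \<Rightarrow> tree" where D: "\<And>i. \<not> fin_cov (D i)"
    "\<And>S. splitting_tree S \<Longrightarrow> S \<subseteq> T \<Longrightarrow> \<exists>s\<in>S. \<exists>i. restrict_tree S s \<subseteq> D i"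
    using countable_non_fin_cov_family[OF no T] by blast
  \<comment> \<open>\<open>n\<close> is both the number of branches and the left end of the
    interval, so the missed positions grow with \<open>n\<close>.\<close>
  define miss where "miss i n b \<longleftrightarrow> (\<forall>x :: nat \<Rightarrow> point. (\<forall>j<n. x j \<in> branches (D i)) \<longrightarrow>
    (\<exists>m\<in>{n..<b}. \<exists>c. \<forall>j<n. x j m \<noteq> c))" for i n b
  have miss_mono: "miss i n b'" if miss: "miss i n b" and "b \<le> b'" for i n b b'
    unfolding miss_def
  proof (intro allI impI)
    fix x :: "nat \<Rightarrow> point" assume "\<forall>j<n. x j \<in> branches (D i)"
    then have "\<exists>m\<in>{n..<b}. \<exists>c. \<forall>j<n. x j m \<noteq> c" using miss unfolding miss_def by simp
    then show "\<exists>m\<in>{n..<b'}. \<exists>c. \<forall>j<n. x j m \<noteq> c"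
      by (rule bexE) (use \<open>b \<le> b'\<close> in \<open>intro bexI, auto\<close>)
  qed
  have "\<forall>i n. \<exists>b. miss i n b" unfolding miss_def by (intro allI uncovered_interval D(1))
  then obtain B where B: "\<And>i n. miss i n (B i n)" by metis
  \<comment> \<open>The maximum over the first \<open>Suc n\<close> trees: any fixed
    \<open>D i\<close> is then handled by \<open>b n\<close> for all \<open>n\<close> from
    \<open>i\<close> on.\<close>
  define b where "b n = Max ((\<lambda>i. B i n) ` {..n})" for n
  have b: "miss i n (b n)" if "i \<le> n" for i n
    using that unfolding b_def by (intro miss_mono[OF B] Max_ge) auto
  define f :: "point \<Rightarrow> nat \<Rightarrow> nat" where "f x n = to_nat (map x [0..<b n])" for x n
  have "f \<in> {f. continuous_on (branches T) f}"
    using continuous_on_initial_segments[of "branches T" "\<lambda>_. to_nat" b] unfolding f_def by simp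
  \<comment> \<open>The growth function is the identity, so \<open>H n\<close> has exactly
    \<open>n\<close> elements.\<close>
  from bspec[OF spec[OF w[unfolded wsacks_cont_def wsacks_def]] this, THEN mp, OF filterlim_ident]
  obtain S a H where S: "splitting_tree S" "S \<subseteq> T" and a: "infinite a"
    and H: "\<And>n. n \<in> a \<Longrightarrow> finite (H n) \<and> card (H n) = n"
    and forced: "S \<tturnstile> f_all a (\<lambda>n. f_value_in (value_name T f x_gen) n (H n))"
    by blast
  obtain s i where s: "s \<in> S" "restrict_tree S s \<subseteq> D i" using D(2)[OF S] by blast
  define R where "R = restrict_tree S s"
  have R: "splitting_tree R" "R \<subseteq> S" "R \<subseteq> D i"
    unfolding R_def using splitting_restrict_tree[OF S(1) s(1)] restrict_tree_subset s(2) by auto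
  have uncovered: "\<exists>m\<ge>n. \<exists>c. \<forall>t\<in>R. m < length t \<longrightarrow> t ! m \<noteq> c" if n: "n \<in> a" "i \<le> n" for n
  proof -
    \<comment> \<open>Each node of this level is a possible initial segment of the generic real, so
      its code belongs to \<open>H n\<close>. Hence the level has at most \<open>n\<close>
      nodes.\<close>
    define L where "L = {t \<in> R. length t = b n}"
    have "to_nat t \<in> H n" if "t \<in> L" for t
    proof (rule forced_value[OF S])
      show "t \<in> S" using that R(2) unfolding L_def by blast
      show "f x n = to_nat t" if "map x [0..<length t] = t" for x
        using that \<open>t \<in> L\<close> unfolding f_def L_def by simp
      show "f_value_in (value_name T f x_gen) n (H n) S"
        using forced n(1) unfolding forces_def f_all_def by blast
    qed
    then have sub: "to_nat ` L \<subseteq> H n" by blast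
    have "finite L" using finite_imageD[OF finite_subset[OF sub]] H[OF n(1)] by (simp add: inj_on_def)
    moreover have "card L \<le> n"
      using card_mono[OF _ sub] H[OF n(1)] card_image[of to_nat L] by (simp add: inj_on_def)
    moreover from \<open>finite L\<close> obtain e where "bij_betw e {0..<card L} L"
      using ex_bij_betw_nat_finite by blast
    moreover from this have "L = e ` {0..<card L}" by (simp add: bij_betw_def)
    ultimately have e: "L \<subseteq> e ` {..<n}" by (metis (no_types) image_mono ivl_subset lessThan_atLeast0 order_refl)
    \<comment> \<open>A branch is assigned to strings outside \<open>R\<close> as well, since
      \<open>e j\<close> is arbitrary for \<open>j\<close> from \<open>card L\<close> on.\<close>
    have "\<exists>x. x \<in> branches R \<and> (t \<in> R \<longrightarrow> map x [0..<length t] = t)" for t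
    proof -
      obtain t0 where "t0 \<in> R" using R(1) unfolding splitting_tree_def by blast
      then show ?thesis using splitting_tree_branch[OF R(1)] by metis
    qed
    then obtain x where x: "\<And>t. x t \<in> branches R" "\<And>t. t \<in> R \<Longrightarrow> map (x t) [0..<length t] = t"
      by metis
    have "\<forall>j<n. x (e j) \<in> branches (D i)" using x(1) branches_mono[OF R(3)] by blast
    then have "\<exists>m\<in>{n..<b n}. \<exists>c. \<forall>j<n. x (e j) m \<noteq> c"
      using b[OF n(2), unfolded miss_def, rule_format, of "\<lambda>j. x (e j)"] by simp
    then obtain m c where m: "m \<in> {n..<b n}" and c: "\<And>j. j < n \<Longrightarrow> x (e j) m \<noteq> c" by metis
    have "t ! m \<noteq> c" if t: "t \<in> R" "m < length t" for t
    proof -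
      \<comment> \<open>Up to height \<open>b n\<close> the branch through \<open>t\<close> agrees
        with the one chosen for its node \<open>u\<close> at that level, and the latter misses
        \<open>c\<close> at \<open>m\<close>.\<close>
      define u where "u = map (x t) [0..<b n]"
      have "u \<in> R" using x(1)[of t] unfolding u_def branches_def by blast
      then have "u \<in> L" unfolding L_def u_def by simp
      then obtain j where j: "j < n" "u = e j" using e by auto
      have "t ! m = x t m" using arg_cong[OF x(2)[OF t(1)], of "\<lambda>l. l ! m"] t(2) by simp
      also have "\<dots> = u ! m" using m by (simp add: u_def)
      also have "\<dots> = x u m"
        using arg_cong[OF x(2)[OF \<open>u \<in> R\<close>], of "\<lambda>l. l ! m"] m by (simp add: u_def)
      also have "\<dots> \<noteq> c" using c j by simp
      finally show ?thesis .
    qed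
    then show ?thesis using m by (metis atLeastLessThan_iff)
  qed
  obtain t where t: "t \<in> R" using R(1) unfolding splitting_tree_def by blast
  obtain N where N: "\<And>n i. n \<ge> N \<Longrightarrow> \<exists>s\<in>restrict_tree R t. n < length s \<and> s ! n = i"
    using splitting_tree_covers[OF R(1) t] by blast
  obtain n where "n \<in> a" "max N i < n" using a unfolding infinite_nat_iff_unbounded by blast
  moreover from this have "i \<le> n" by simp
  ultimately obtain m c where "m \<ge> n" and mc: "\<forall>t\<in>R. m < length t \<longrightarrow> t ! m \<noteq> c"
    using uncovered[of n] by metis
  then have "m \<ge> N" using \<open>max N i < n\<close> by simp
  from N[OF this, of c] show False using mc restrict_tree_subset[of R t] by (metis subsetD)
qed

section \<open>From finite covers to the weak Sacks property\<close>

text \<open>The level \<open>F (Suc k)\<close> extends initial segments of covering branches of the nodes in \<open>F k\<close>, cut at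
  two different heights. The second, higher cut covers the gap between the first cut and the place
  from which the covers above the new nodes take over. The size of \<open>F (Suc k)\<close> is bounded in terms of
  \<open>F k\<close> alone, so \<open>\<nu> (Suc k)\<close> can be chosen after this bound is known.\<close>

lemma fusion:
  assumes S: "splitting_tree S" and cov: "\<And>s. s \<in> S \<Longrightarrow> fin_cov (restrict_tree S s)"
    and dense: "\<And>n k s. s \<in> S \<Longrightarrow> \<exists>t\<in>S \<inter> Q n k. prefix s t"
    and g: "filterlim g at_top sequentially"
  obtains S' F \<nu> where "splitting_tree S'" "S' \<subseteq> S" "strict_mono (\<nu> :: nat \<Rightarrow> nat)"
    "\<And>k. finite (F k)" "\<And>k. card (F k) \<le> g (\<nu> k)" "\<And>k. F k \<subseteq> Q (\<nu> k) k"
    "\<And>k x. x \<in> branches S' \<Longrightarrow> \<exists>t\<in>F k. map x [0..<length t] = t"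
proof -
  have "\<exists>X m. X \<subseteq> branches (restrict_tree S s) \<and> finite X \<and> length s \<le> m \<and>
      (\<forall>i\<ge>m. \<forall>c. \<exists>x\<in>X. x i = c)" if "s \<in> S" for s
  proof -
    obtain X N where "X \<subseteq> branches (restrict_tree S s)" "finite X" "\<forall>i\<ge>N. \<forall>c. \<exists>x\<in>X. x i = c"
      using cov[OF \<open>s \<in> S\<close>] unfolding fin_cov_def covers_cofinite_inf_seq_iff by blast
    then show ?thesis by (intro exI[of _ X] exI[of _ "max N (length s)"]) simp
  qed
  then obtain X m where X: "\<And>s. s \<in> S \<Longrightarrow> X s \<subseteq> branches (restrict_tree S s)"
    "\<And>s. s \<in> S \<Longrightarrow> finite (X s)" and m: "\<And>s. s \<in> S \<Longrightarrow> length s \<le> m s"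
    and Xm: "\<And>s i c. s \<in> S \<Longrightarrow> m s \<le> i \<Longrightarrow> \<exists>x\<in>X s. x i = c"
    by metis
  define e where "e n k s = (SOME t. t \<in> S \<inter> Q n k \<and> prefix s t)" for n k s
  have e: "e n k s \<in> S \<inter> Q n k \<and> prefix s (e n k s)" if "s \<in> S" for n k s
    unfolding e_def by (rule someI_ex) (use dense[OF that, of n k] in blast)
  \<comment> \<open>In the last clause the nodes of \<open>F'\<close> above \<open>s\<close> cover
    all positions from \<open>m s\<close> until the cover of some \<open>t\<close> in
    \<open>F'\<close> takes over. The maximum with \<open>k\<close> guarantees progress even if
    \<open>m t\<close> stays small.\<close>
  define step where "step k F F' n \<longleftrightarrow> finite F' \<and> F' \<subseteq> S \<inter> Q n k \<and> card F' \<le> g n \<and>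
    (\<forall>t\<in>F'. k \<le> length t \<and> (\<exists>s\<in>F. prefix s t)) \<and>
    (\<forall>s\<in>F. \<exists>t\<in>F'. prefix s t \<and> (\<forall>i c. m s \<le> i \<and> i < max k (m t) \<longrightarrow>
      (\<exists>u\<in>F'. prefix s u \<and> i < length u \<and> u ! i = c)))" for k F F' and n :: nat
  have step: "\<exists>F' n. n0 < n \<and> step k F F' n" if F: "finite F" "F \<subseteq> S" for k F n0
  proof -
    define I where "I = Sigma F X"
    have finI: "finite I" unfolding I_def using F X(2) by blast
    \<comment> \<open>Each of the two cuts has at most one node per pair in \<open>I\<close>,
      whatever its height and whatever \<open>n\<close> is.\<close>
    obtain n where n: "n0 < n" "2 * card I \<le> g n"
      using g unfolding filterlim_at_top eventually_sequentially by (metis less_Suc_eq_le nat_le_linear not_less)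
    define cut where "cut L = (\<lambda>(s, x). e n k (map x [0..<L])) ` I" for L
    define L1 where "L1 = Max (insert k (m ` F))"
    have L1: "k \<le> L1" "\<And>s. s \<in> F \<Longrightarrow> m s \<le> L1"
      using F(1) unfolding L1_def by simp_all
    have seg: "map x [0..<L] \<in> S" "prefix s (map x [0..<L])"
      if "s \<in> F" "x \<in> X s" "L1 \<le> L" for s x L
    proof -
      have "s \<in> S" using F(2) \<open>s \<in> F\<close> by blast
      then have "x \<in> branches S" "map x [0..<length s] = s"
        using X(1) \<open>x \<in> X s\<close> by (blast dest: branches_restrict_tree_iff[THEN iffD1])+
      moreover have "length s \<le> L" using m[OF \<open>s \<in> S\<close>] L1(2)[OF \<open>s \<in> F\<close>] \<open>L1 \<le> L\<close> by simp
      ultimately show "map x [0..<L] \<in> S" "prefix s (map x [0..<L])"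
        by (simp_all add: branches_def prefix_map_upt_iff)
    qed
    have cutE: "\<exists>s\<in>F. \<exists>x\<in>X s. t = e n k (map x [0..<L])" if "t \<in> cut L" for t L
      using that unfolding cut_def I_def by auto
    have fin_cut: "finite (cut L)" "card (cut L) \<le> card I" for L
      unfolding cut_def using finI card_image_le by blast+
    have cut_sub: "cut L \<subseteq> S \<inter> Q n k" if "L1 \<le> L" for L
      using cutE e seg(1) that by blast
    have cut_prefix: "k \<le> length t \<and> (\<exists>s\<in>F. prefix s t)" if "L1 \<le> L" "t \<in> cut L" for L t
    proof -
      obtain s x where sx: "s \<in> F" "x \<in> X s" "t = e n k (map x [0..<L])"
        using cutE[OF \<open>t \<in> cut L\<close>] by blast
      have "prefix (map x [0..<L]) t" using e[OF seg(1)[OF sx(1,2) \<open>L1 \<le> L\<close>]] sx(3) by blast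
      then show ?thesis
        using prefix_length_le[of "map x [0..<L]" t] L1(1) \<open>L1 \<le> L\<close>
          prefix_order.trans[OF seg(2)[OF sx(1,2) \<open>L1 \<le> L\<close>]] sx(1) by auto
    qed
    have cut_cover: "\<exists>u\<in>cut L. prefix s u \<and> i < length u \<and> u ! i = c"
      if "L1 \<le> L" "s \<in> F" "m s \<le> i" "i < L" for L s i c
    proof -
      obtain x where x: "x \<in> X s" "x i = c" using Xm[of s i c] \<open>m s \<le> i\<close> F(2) \<open>s \<in> F\<close> by blast
      define u where "u = e n k (map x [0..<L])"
      have u: "prefix (map x [0..<L]) u"
        using e[OF seg(1)[OF \<open>s \<in> F\<close> x(1) \<open>L1 \<le> L\<close>]] unfolding u_def by blast
      have "u \<in> cut L" unfolding u_def cut_def I_def using x(1) \<open>s \<in> F\<close> by force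
      moreover have "prefix s u" using seg(2)[OF \<open>s \<in> F\<close> x(1) \<open>L1 \<le> L\<close>] u by (rule prefix_order.trans)
      moreover have "i < length u" using prefix_length_le[OF u] \<open>i < L\<close> by simp
      moreover have "u ! i = c" using prefix_nth[OF u, of i] \<open>i < L\<close> x(2) by simp
      ultimately show ?thesis by blast
    qed
    \<comment> \<open>The second cut is above \<open>m t\<close> for every node \<open>t\<close> of
      the first, and above \<open>k\<close> because \<open>L1\<close> is.\<close>
    define L2 where "L2 = Max (insert L1 (m ` cut L1))"
    have L2: "L1 \<le> L2" "\<And>t. t \<in> cut L1 \<Longrightarrow> m t \<le> L2"
      using fin_cut(1) unfolding L2_def by simp_all
    have "step k F (cut L1 \<union> cut L2) n"
      unfolding step_def
    proof (intro conjI ballI)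
      show "finite (cut L1 \<union> cut L2)" using fin_cut(1) by simp
      show "cut L1 \<union> cut L2 \<subseteq> S \<inter> Q n k" using cut_sub L2(1) by simp
      show "card (cut L1 \<union> cut L2) \<le> g n"
        using card_Un_le[of "cut L1" "cut L2"] fin_cut(2)[of L1] fin_cut(2)[of L2] n(2) by simp
      show "k \<le> length t" "\<exists>s\<in>F. prefix s t" if "t \<in> cut L1 \<union> cut L2" for t
        using that cut_prefix[of L1 t] cut_prefix[of L2 t] L2(1) by auto
      fix s assume s: "s \<in> F"
      then have "s \<in> S" using F(2) by blast
      then obtain x where x: "x \<in> X s" using Xm[of s "m s" True] by blast
      define t where "t = e n k (map x [0..<L1])"
      have t: "t \<in> cut L1" unfolding t_def cut_def I_def using x s by force
      have "prefix s t" unfolding t_def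
        using seg(2)[OF s x order_refl] e[OF seg(1)[OF s x order_refl]] prefix_order.trans by blast
      moreover have "\<exists>u\<in>cut L1 \<union> cut L2. prefix s u \<and> i < length u \<and> u ! i = c"
        if "m s \<le> i \<and> i < max k (m t)" for i c
      proof -
        have "i < L2" using that L2 t L1(1) by (metis le_trans less_le_trans less_max_iff_disj)
        then show ?thesis using cut_cover[OF L2(1) s, of i c] that by blast
      qed
      ultimately show "\<exists>t\<in>cut L1 \<union> cut L2. prefix s t \<and> (\<forall>i c. m s \<le> i \<and> i < max k (m t) \<longrightarrow>
          (\<exists>u\<in>cut L1 \<union> cut L2. prefix s u \<and> i < length u \<and> u ! i = c))"
        using t by (intro bexI[of _ t]) simp_all
    qed
    then show ?thesis using n(1) by blast
  qed
  have nil: "[] \<in> S"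
    using S unfolding splitting_tree_def is_tree_def by (meson Nil_prefix all_not_in_conv)
  have "\<exists>\<sigma>. \<forall>k. (finite (fst (\<sigma> k)) \<and> fst (\<sigma> k) \<subseteq> S \<and> (k = 0 \<longrightarrow> fst (\<sigma> k) = {[]})) \<and>
      (snd (\<sigma> k) < snd (\<sigma> (Suc k)) \<and> step k (fst (\<sigma> k)) (fst (\<sigma> (Suc k))) (snd (\<sigma> (Suc k))))"
  proof (rule dependent_nat_choice)
    show "\<exists>p :: tree \<times> nat. finite (fst p) \<and> fst p \<subseteq> S \<and> (0 = (0::nat) \<longrightarrow> fst p = {[]})"
      using nil by (intro exI[of _ "({[]}, 0)"]) simp
    fix p :: "tree \<times> nat" and k :: nat
    assume p: "finite (fst p) \<and> fst p \<subseteq> S \<and> (k = 0 \<longrightarrow> fst p = {[]})"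
    then have "\<exists>F' n. snd p < n \<and> step k (fst p) F' n" by (intro step) auto
    then obtain F' n where F': "snd p < n" "step k (fst p) F' n" by (elim exE conjE)
    then have "finite F'" "F' \<subseteq> S" unfolding step_def by auto
    then show "\<exists>p'. (finite (fst p') \<and> fst p' \<subseteq> S \<and> (Suc k = 0 \<longrightarrow> fst p' = {[]})) \<and>
        (snd p < snd p' \<and> step k (fst p) (fst p') (snd p'))"
      using F' by (intro exI[of _ "(F', n)"]) simp
  qed
  then obtain \<sigma> where \<sigma>: "\<forall>k. (finite (fst (\<sigma> k)) \<and> fst (\<sigma> k) \<subseteq> S \<and> (k = 0 \<longrightarrow> fst (\<sigma> k) = {[]})) \<and>
      (snd (\<sigma> k) < snd (\<sigma> (Suc k)) \<and> step k (fst (\<sigma> k)) (fst (\<sigma> (Suc k))) (snd (\<sigma> (Suc k))))" ..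
  \<comment> \<open>Indices shift by one: \<open>G 0\<close> is just the root and need not lie in
    any \<open>Q n k\<close>, so the levels returned start with \<open>G (Suc 0)\<close>.\<close>
  define G \<nu> where "G k = fst (\<sigma> k)" and "\<nu> k = snd (\<sigma> (Suc k))" for k
  have G: "finite (G k)" "G k \<subseteq> S" and G0: "G 0 = {[]}" and \<nu>: "\<nu> k < \<nu> (Suc k)"
    and st: "step k (G k) (G (Suc k)) (\<nu> k)" for k
    using \<sigma> unfolding G_def \<nu>_def by simp_all
  have down: "\<exists>s\<in>G k. prefix s t" if "k \<le> j" "t \<in> G j" for j k t
    using that
  proof (induction arbitrary: t rule: dec_induct)
    case base
    then show ?case by blast
  next
    case (step j)
    then obtain s where "s \<in> G j" "prefix s t" using st[of j] unfolding step_def by blast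
    then show ?case using step.IH[of s] prefix_order.trans by blast
  qed
  have up: "\<exists>s\<in>G k. prefix t s" if "j \<le> k" "t \<in> G j" for j k t
    using that
  proof (induction rule: dec_induct)
    case base
    then show ?case by blast
  next
    case (step k)
    then obtain s where s: "s \<in> G k" "prefix t s" by blast
    then obtain s' where "s' \<in> G (Suc k)" "prefix s s'" using st[of k] unfolding step_def by blast
    then show ?case using s prefix_order.trans by blast
  qed
  \<comment> \<open>Induction on the number of levels still to climb: either the next level covers
    \<open>i\<close> above \<open>s\<close>, or \<open>m t \<le> i\<close> for the node
    \<open>t\<close> that takes over. This stops once the level number exceeds
    \<open>i\<close>.\<close>
  have cover: "\<exists>j. \<exists>u\<in>G j. prefix s u \<and> i < length u \<and> u ! i = c"
    if "s \<in> G k" "m s \<le> i" "i < k + d" for d k s i c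
    using that
  proof (induction d arbitrary: k s)
    case (0 k s)
    then show ?case using st[of k] unfolding step_def by (metis add_0_right less_max_iff_disj)
  next
    case (Suc d k s)
    obtain t where t: "t \<in> G (Suc k)" "prefix s t" "\<And>i c. m s \<le> i \<Longrightarrow> i < max k (m t) \<Longrightarrow>
        \<exists>u\<in>G (Suc k). prefix s u \<and> i < length u \<and> u ! i = c"
      using st[of k] Suc.prems(1) unfolding step_def by metis
    show ?case
    proof (cases "i < max k (m t)")
      case True
      then show ?thesis using t(3)[OF Suc.prems(2)] by metis
    next
      case False
      then have "m t \<le> i" "i < Suc k + d" using Suc.prems(3) by simp_all
      from Suc.IH[OF t(1) this] obtain j u where "u \<in> G j" "prefix t u" "i < length u" "u ! i = c"
        by metis
      then show ?thesis using prefix_order.trans[OF t(2)] by metis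
    qed
  qed
  define S' where "S' = {t. \<exists>k. \<exists>u\<in>G k. prefix t u}"
  have "splitting_tree S'"
    unfolding splitting_tree_def
  proof (intro conjI ballI)
    show "is_tree S'" unfolding is_tree_def S'_def using prefix_order.trans by blast
    show "S' \<noteq> {}" unfolding S'_def using G0 by blast
    fix t assume "t \<in> S'"
    then obtain k u where u: "u \<in> G k" "prefix t u" unfolding S'_def by blast
    have "\<exists>s\<in>restrict_tree S' t. n < length s \<and> s ! n = i" if "m u \<le> n" for n i
    proof -
      obtain j v where v: "v \<in> G j" "prefix u v" "n < length v" "v ! n = i"
        using cover[OF u(1) \<open>m u \<le> n\<close>, of "Suc n" i] by auto
      then have "v \<in> restrict_tree S' t"
        using prefix_order.trans[OF u(2) v(2)] unfolding restrict_tree_def S'_def by blast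
      then show ?thesis using v by metis
    qed
    then show "covers_cofinite (fin_seq ` restrict_tree S' t)"
      unfolding covers_cofinite_fin_seq_iff by metis
  qed
  moreover have "S' \<subseteq> S"
    using G(2) is_treeD[OF splitting_tree_is_tree[OF S]] unfolding S'_def by blast
  moreover have "strict_mono \<nu>" using \<nu> by (simp add: strict_mono_Suc_iff)
  moreover have "finite (G (Suc k))" "card (G (Suc k)) \<le> g (\<nu> k)" "G (Suc k) \<subseteq> Q (\<nu> k) k" for k
    using st[of k] unfolding step_def by simp_all
  moreover have "\<exists>t\<in>G (Suc k). map x [0..<length t] = t" if x: "x \<in> branches S'" for k x
  proof -
    \<comment> \<open>\<open>l\<close> exceeds all lengths in \<open>G (Suc k)\<close>. A node
      \<open>u\<close> with \<open>l\<close> entries thus has no extension there, so it comes from a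
      later level and lies above a node of \<open>G (Suc k)\<close>.\<close>
    define l where "l = Suc (Max (insert 0 (length ` G (Suc k))))"
    have l: "length t < l" if "t \<in> G (Suc k)" for t
      using G(1) that unfolding l_def by (simp add: less_Suc_eq_le)
    obtain j u where u: "u \<in> G j" "prefix (map x [0..<l]) u"
      using x unfolding branches_def S'_def by blast
    show ?thesis
    proof (cases "j \<le> Suc k")
      case True
      then obtain s where "s \<in> G (Suc k)" "prefix u s" using up u(1) by blast
      then show ?thesis using l prefix_length_le[of u s] prefix_length_le[OF u(2)] by fastforce
    next
      case False
      then obtain s where s: "s \<in> G (Suc k)" "prefix s u" using down[of "Suc k" j u] u(1) by auto
      then have "prefix s (map x [0..<l])"
        using prefix_length_prefix[OF s(2) u(2)] l[OF s(1)] by simp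
      then show ?thesis using s(1) by (auto simp: prefix_map_upt_iff)
    qed
  qed
  ultimately show ?thesis by (rule that)
qed

section \<open>Baire category in the space of branches\<close>

lemma openin_branches_cylinder:
  assumes "openin (top_of_set (branches S)) U" "x \<in> U" "map x [0..<length s] = s"
  obtains t where "t \<in> S" "prefix s t" "map x [0..<length t] = t" "branches (restrict_tree S t) \<subseteq> U"
proof -
  obtain V where V: "open V" "U = branches S \<inter> V" using assms(1) by (auto simp: openin_open)
  then obtain k where k: "{y. map y [0..<k] = map x [0..<k]} \<subseteq> V"
    using cylinder_subset_open[OF V(1), of x] assms(2) by blast
  define t where "t = map x [0..<max k (length s)]"
  have "t \<in> S" using assms(2) V(2) unfolding t_def branches_def by blast
  moreover have "prefix s t" using assms(3) by (simp add: t_def prefix_map_upt_iff)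
  moreover have "map x [0..<length t] = t" by (simp add: t_def)
  moreover have "branches (restrict_tree S t) \<subseteq> U"
  proof
    fix y assume "y \<in> branches (restrict_tree S t)"
    then have y: "y \<in> branches S" "map y [0..<length t] = t" by (auto simp: branches_restrict_tree_iff)
    have "prefix (map x [0..<k]) t" unfolding t_def by (intro prefix_map_upt) simp
    then have "prefix (map x [0..<k]) (map y [0..<length t])" using y(2) by simp
    then have "map y [0..<k] = map x [0..<k]" by (simp add: prefix_map_upt_iff)
    then have "y \<in> V" using k by blast
    then show "y \<in> U" using V(2) y(1) by simp
  qed
  ultimately show ?thesis using that by blast
qed

text \<open>The cylinder of \<open>s\<close> is open and nonempty, so it is not contained in the
  closure of \<open>N\<close>. A point of it outside the closure has a cylinder inside the
  complement.\<close>

lemma nowhere_dense_in_avoid: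
  assumes S: "splitting_tree S" "s \<in> S" and N: "nowhere_dense_in (top_of_set (branches S)) N"
  shows "\<exists>t\<in>S. prefix s t \<and> branches (restrict_tree S t) \<inter> N = {}"
proof -
  let ?X = "top_of_set (branches S)"
  have "openin ?X (branches (restrict_tree S s))"
  proof -
    have "branches (restrict_tree S s) = branches S \<inter> {y. map y [0..<length s] = s}"
      by (auto simp: branches_restrict_tree_iff)
    then show ?thesis using openin_open_Int[OF open_cylinder] by simp
  qed
  moreover have "branches (restrict_tree S s) \<noteq> {}"
    using splitting_tree_branch[OF S] branches_restrict_tree_iff by (metis empty_iff)
  ultimately have "\<not> branches (restrict_tree S s) \<subseteq> ?X closure_of N"
    using N interior_of_maximal[of _ "?X closure_of N" ?X] unfolding nowhere_dense_in_def by blast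
  then obtain x where x: "x \<in> branches (restrict_tree S s)" "x \<notin> ?X closure_of N" by blast
  then have "x \<in> branches S - ?X closure_of N" "map x [0..<length s] = s"
    by (auto simp: branches_restrict_tree_iff)
  moreover have "openin ?X (branches S - ?X closure_of N)"
    using openin_diff[OF openin_topspace[of ?X] closedin_closure_of[of ?X N]] by simp
  ultimately obtain t where t: "t \<in> S" "prefix s t"
    "branches (restrict_tree S t) \<subseteq> branches S - ?X closure_of N"
    using openin_branches_cylinder by metis
  moreover have "N \<subseteq> ?X closure_of N"
    using N closure_of_subset unfolding nowhere_dense_in_def by blast
  ultimately show ?thesis by blast
qed

lemma wsacks_baire_if_subtree:
  assumes S: "splitting_tree S" "S \<subseteq> T"
    and cov: "\<And>s. s \<in> S \<Longrightarrow> finitely_covering (restrict_tree S s)"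
  shows "wsacks_baire T"
  unfolding wsacks_baire_def wsacks_def
proof (intro allI ballI impI)
  fix g :: "nat \<Rightarrow> nat" and f :: "point \<Rightarrow> nat \<Rightarrow> nat"
  assume "f \<in> {f. baire_measurable_on (branches T) f}" and g: "filterlim g at_top sequentially"
  then have f: "baire_measurable_on (branches T) f" by simp
  let ?X = "top_of_set (branches S)"
  \<comment> \<open>Here the restricted Baire property is used: \<open>branches S\<close> may be
    nowhere dense in \<open>branches T\<close>.\<close>
  have "baire_property_in ?X (branches S \<inter> f -` {y. y n = m})" for n m :: nat
  proof -
    have "open {y :: nat \<Rightarrow> nat. y n = m}"
      using open_vimage[OF open_discrete[of "{m}"] continuous_on_product_coordinates[of n]]
      by (simp add: vimage_def)
    then show ?thesis
      using f branches_mono[OF S(2)] unfolding baire_measurable_on_def by metis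
  qed
  then have "\<forall>n m :: nat. \<exists>U N. openin ?X U \<and> (\<forall>j :: nat. nowhere_dense_in ?X (N j)) \<and>
      (branches S \<inter> f -` {y. y n = m} - U) \<union> (U - branches S \<inter> f -` {y. y n = m}) = (\<Union>j. N j)"
    unfolding baire_property_in_def meager_in_def by metis
  then obtain U N where U: "\<And>n m. openin ?X (U n m)"
    and N: "\<And>n m j :: nat. nowhere_dense_in ?X (N n m j)"
    and UN: "\<And>n m. (branches S \<inter> f -` {y. y n = m} - U n m) \<union>
      (U n m - branches S \<inter> f -` {y. y n = m}) = (\<Union>j. N n m j)"
    by metis
  \<comment> \<open>All exceptional nowhere dense sets in a single sequence. Outside their union the
    open sets \<open>U n m\<close> describe \<open>f\<close> exactly.\<close>
  define M where "M = (\<lambda>i. case from_nat i of (n, m, j) \<Rightarrow> N n m j)"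
  have M: "nowhere_dense_in ?X (M i)" for i using N by (simp add: M_def split: prod.split)
  have N_M: "N n m j \<subseteq> (\<Union>i. M i)" for n m j
  proof -
    have "N n m j = M (to_nat (n, m, j))" by (simp add: M_def)
    then show ?thesis by blast
  qed
  have in_U_iff: "x \<in> U n m \<longleftrightarrow> f x n = m" if "x \<in> branches S" "x \<notin> (\<Union>i. M i)" for x n m
  proof -
    have "x \<notin> (\<Union>j. N n m j)" using that(2) N_M by blast
    then show ?thesis using UN[of n m] that(1) by blast
  qed
  \<comment> \<open>Nodes that decide the value at \<open>n\<close> off the exceptional sets and
    already avoid the first \<open>k\<close> of these sets.\<close>
  define Q where "Q n k = {t. (\<exists>m. branches (restrict_tree S t) \<subseteq> U n m) \<and>
      (\<forall>i<k. branches (restrict_tree S t) \<inter> M i = {})}" for n k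
  note shrink = branches_restrict_tree_antimono[of _ _ S]
  have avoid: "\<exists>t\<in>S. prefix s t \<and> (\<forall>i<k. branches (restrict_tree S t) \<inter> M i = {})" if "s \<in> S" for s k
  proof (induction k)
    case 0
    then show ?case using that by blast
  next
    case (Suc k)
    then obtain t where t: "t \<in> S" "prefix s t" "\<forall>i<k. branches (restrict_tree S t) \<inter> M i = {}"
      by blast
    obtain u where u: "u \<in> S" "prefix t u" "branches (restrict_tree S u) \<inter> M k = {}"
      using nowhere_dense_in_avoid[OF S(1) t(1) M] by blast
    have "\<forall>i<Suc k. branches (restrict_tree S u) \<inter> M i = {}"
      using t(3) u(3) shrink[OF u(2)] by (auto simp: less_Suc_eq)
    then show ?case using u(1) prefix_order.trans[OF t(2) u(2)] by blast
  qed
  \<comment> \<open>The Baire category theorem inside the cylinder of \<open>s\<close>, by a chain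
    of nodes that avoid one more \<open>M k\<close> at each stage.\<close>
  have generic: "\<exists>x\<in>branches S. map x [0..<length s] = s \<and> x \<notin> (\<Union>i. M i)" if s: "s \<in> S" for s
  proof -
    have "\<exists>t. \<forall>k. (t k \<in> S \<and> k \<le> length (t k) \<and> prefix s (t k)) \<and>
        (prefix (t k) (t (Suc k)) \<and> branches (restrict_tree S (t (Suc k))) \<inter> M k = {})"
    proof (rule dependent_nat_choice)
      show "\<exists>t. t \<in> S \<and> 0 \<le> length t \<and> prefix s t" using s by blast
      fix t :: "bool list" and k :: nat
      assume t: "t \<in> S \<and> k \<le> length t \<and> prefix s t"
      then obtain u where u: "u \<in> S" "prefix t u" "length u = max (Suc k) (length t)"
        using splitting_tree_extend[OF S(1), of t "Suc k"] by blast
      obtain v where v: "v \<in> S" "prefix u v" "branches (restrict_tree S v) \<inter> M k = {}"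
        using nowhere_dense_in_avoid[OF S(1) u(1) M] by blast
      have tv: "prefix t v" using prefix_order.trans[OF u(2) v(2)] .
      moreover have "prefix s v" using t tv prefix_order.trans by blast
      moreover have "Suc k \<le> length v" using u(3) prefix_length_le[OF v(2)] by simp
      ultimately show "\<exists>v. (v \<in> S \<and> Suc k \<le> length v \<and> prefix s v) \<and>
          (prefix t v \<and> branches (restrict_tree S v) \<inter> M k = {})"
        using v by blast
    qed
    then obtain t where t: "\<forall>k. (t k \<in> S \<and> k \<le> length (t k) \<and> prefix s (t k)) \<and>
        (prefix (t k) (t (Suc k)) \<and> branches (restrict_tree S (t (Suc k))) \<inter> M k = {})" ..
    obtain x where x: "x \<in> branches S" "\<And>k. map x [0..<length (t k)] = t k"
      by (rule branch_of_chain[of S t]) (use t splitting_tree_is_tree[OF S(1)] in blast)+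
    have "x \<notin> M k" for k
    proof -
      have "x \<in> branches (restrict_tree S (t (Suc k)))" using x by (simp add: branches_restrict_tree_iff)
      then show ?thesis using t by blast
    qed
    moreover have "map x [0..<length s] = s"
    proof -
      have "prefix s (map x [0..<length (t 0)])" using t x(2)[of 0] by simp
      then show ?thesis by (simp add: prefix_map_upt_iff)
    qed
    ultimately show ?thesis using x(1) by blast
  qed
  have dense: "\<exists>t\<in>S \<inter> Q n k. prefix s t" if s: "s \<in> S" for n k s
  proof -
    obtain x where x: "x \<in> branches S" "map x [0..<length s] = s" "x \<notin> (\<Union>i. M i)"
      using generic[OF s] by blast
    \<comment> \<open>The generic point supplies the value to be decided: the open set for its own
      value contains a cylinder around it.\<close>
    have "x \<in> U n (f x n)" using in_U_iff[OF x(1,3), of n "f x n"] by simp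
    then obtain t where t: "t \<in> S" "prefix s t" "branches (restrict_tree S t) \<subseteq> U n (f x n)"
      using openin_branches_cylinder[OF U _ x(2)] by blast
    obtain u where u: "u \<in> S" "prefix t u" "\<forall>i<k. branches (restrict_tree S u) \<inter> M i = {}"
      using avoid[OF t(1)] by blast
    have "branches (restrict_tree S u) \<subseteq> U n (f x n)" using shrink[OF u(2)] t(3) by blast
    then have "u \<in> Q n k" using u(3) unfolding Q_def by blast
    then show ?thesis using u(1) prefix_order.trans[OF t(2) u(2)] by blast
  qed
  have cov': "fin_cov (restrict_tree S s)" if "s \<in> S" for s
    using cov[OF that] by (simp add: finitely_covering_iff)
  obtain S' F \<nu> where S': "splitting_tree S'" "S' \<subseteq> S" and \<nu>: "strict_mono (\<nu> :: nat \<Rightarrow> nat)"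
    and F: "\<And>k. finite (F k)" "\<And>k. card (F k) \<le> g (\<nu> k)" "\<And>k. F k \<subseteq> Q (\<nu> k) k"
    and FS': "\<And>k x. x \<in> branches S' \<Longrightarrow> \<exists>t\<in>F k. map x [0..<length t] = t"
    by (rule fusion[of S Q g, OF S(1) cov' dense g]) (assumption, assumption, rule that)
  define \<mu> where "\<mu> k t = (SOME m. branches (restrict_tree S t) \<subseteq> U (\<nu> k) m)" for k t
  have \<mu>: "branches (restrict_tree S t) \<subseteq> U (\<nu> k) (\<mu> k t)" if "t \<in> F k" for k t
    unfolding \<mu>_def by (rule someI_ex) (use F(3)[of k] that in \<open>auto simp: Q_def\<close>)
  have avoids: "x \<notin> (\<Union>i. M i)" if x: "x \<in> branches S'" for x
  proof
    assume "x \<in> (\<Union>i. M i)"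
    then obtain i where i: "x \<in> M i" by blast
    \<comment> \<open>Level \<open>Suc i\<close>, since \<open>Q n k\<close> avoids
      \<open>M i\<close> only for \<open>i < k\<close>.\<close>
    obtain t where t: "t \<in> F (Suc i)" "map x [0..<length t] = t" using FS'[OF x] by blast
    then have "x \<in> branches (restrict_tree S t)"
      using branches_mono[OF S'(2)] x by (auto simp: branches_restrict_tree_iff)
    moreover have "branches (restrict_tree S t) \<inter> M i = {}"
      using F(3)[of "Suc i"] t(1) unfolding Q_def by blast
    ultimately show False using i by blast
  qed
  have f_eq: "f x (\<nu> k) = \<mu> k t" if "x \<in> branches S'" "t \<in> F k" "map x [0..<length t] = t" for x k t
  proof -
    have x: "x \<in> branches S" using that(1) branches_mono[OF S'(2)] by blast
    then have "x \<in> branches (restrict_tree S t)" using that(3) by (simp add: branches_restrict_tree_iff)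
    then show ?thesis using \<mu>[OF that(2)] in_U_iff[OF x avoids[OF that(1)]] by blast
  qed
  have "\<exists>B :: nat set. finite B \<and> card B = g (\<nu> k) \<and> \<mu> k ` F k \<subseteq> B" for k
  proof -
    \<comment> \<open>The decided values are padded with small numbers, because \<open>H\<close>
      must have exactly \<open>g (\<nu> k)\<close> elements.\<close>
    let ?C = "\<mu> k ` F k \<union> {..<g (\<nu> k)}"
    have "finite ?C" using F(1) by simp
    moreover have "card (\<mu> k ` F k) \<le> g (\<nu> k)"
      using F(2)[of k] card_image_le[OF F(1), of "\<mu> k" k] by simp
    moreover have "g (\<nu> k) \<le> card ?C" using card_mono[OF \<open>finite ?C\<close>, of "{..<g (\<nu> k)}"] by simp
    ultimately obtain B where "\<mu> k ` F k \<subseteq> B" "B \<subseteq> ?C" "card B = g (\<nu> k)"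
      using exists_subset_between[of "\<mu> k ` F k" "g (\<nu> k)" ?C] by blast
    then show ?thesis using finite_subset[OF _ \<open>finite ?C\<close>] by blast
  qed
  then have "\<forall>k. \<exists>B :: nat set. finite B \<and> card B = g (\<nu> k) \<and> \<mu> k ` F k \<subseteq> B" ..
  from choice[OF this] obtain B :: "nat \<Rightarrow> nat set" where
    "\<forall>k. finite (B k) \<and> card (B k) = g (\<nu> k) \<and> \<mu> k ` F k \<subseteq> B k" ..
  then have B: "\<And>k. finite (B k)" "\<And>k. card (B k) = g (\<nu> k)" "\<And>k. \<mu> k ` F k \<subseteq> B k"
    by simp_all
  define H where "H n = B (inv \<nu> n)" for n
  have H: "H (\<nu> k) = B k" for k
    unfolding H_def using strict_mono_imp_inj_on[OF \<nu>] by (simp add: inv_f_f)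
  have forced: "f_value_in (value_name T f x_gen) (\<nu> k) (H (\<nu> k)) S'" for k
    unfolding f_value_in_def f_ex_def dense_below_def
  proof (intro allI impI)
    fix q assume q: "splitting_tree q \<and> q \<subseteq> S'"
    then obtain t0 where "t0 \<in> q" unfolding splitting_tree_def by blast
    then obtain x where x: "x \<in> branches q" using splitting_tree_branch q by blast
    have "x \<in> branches S'" using x branches_mono[of q S'] q by blast
    then obtain t where t: "t \<in> F k" "map x [0..<length t] = t"
      using FS'[of x k] by blast
    \<comment> \<open>A branch of \<open>q\<close> passes through a node of \<open>F k\<close>, so
      restricting \<open>q\<close> to this node gives a condition on whose branches the value is
      constant.\<close>
    have "t \<in> q" using x t(2) unfolding branches_def by (metis (mono_tags, lifting) mem_Collect_eq)
    define r where "r = restrict_tree q t"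
    have r: "splitting_tree r" "r \<subseteq> q" "r \<subseteq> T"
      using splitting_restrict_tree[of q t] q \<open>t \<in> q\<close> restrict_tree_subset[of q t] S'(2) S(2)
      unfolding r_def by blast+
    have f_r: "\<forall>y\<in>branches r. f y (\<nu> k) = \<mu> k t"
    proof
      fix y assume "y \<in> branches r"
      then have "y \<in> branches q" "map y [0..<length t] = t"
        unfolding r_def by (simp_all add: branches_restrict_tree_iff)
      moreover from this(1) have "y \<in> branches S'" using branches_mono[of q S'] q by blast
      ultimately show "f y (\<nu> k) = \<mu> k t" using f_eq[OF _ t(1)] by blast
    qed
    \<comment> \<open>\<open>r\<close> serves both as the condition and as the tree of which it
      forces the generic real to be a branch.\<close>
    have "((\<nu> k, \<mu> k t), r) \<in> value_name T f x_gen"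
      unfolding value_name_def mem_Collect_eq
      by (intro exI[of _ "\<nu> k"] exI[of _ "\<mu> k t"] exI[of _ r] conjI refl r(3) f_r
          splitting_tree_is_tree[OF r(1)] forces_f_branch_self[OF r(1)])
    then have "f_mem (\<nu> k, \<mu> k t) (value_name T f x_gen) r"
      unfolding f_mem_def dense_below_def by (metis order_refl)
    moreover have "\<mu> k t \<in> H (\<nu> k)" using B(3) t(1) H by blast
    ultimately show "\<exists>r. splitting_tree r \<and> r \<subseteq> q \<and>
        (\<exists>m\<in>H (\<nu> k). f_mem (\<nu> k, m) (value_name T f x_gen) r)"
      using r(1,2) by blast
  qed
  show "\<exists>S a H. splitting_tree S \<and> S \<subseteq> T \<and> infinite a \<and> (\<forall>n\<in>a. finite (H n) \<and> card (H n) = g n) \<and>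
      S \<tturnstile> f_all a (\<lambda>n. f_value_in (value_name T f x_gen) n (H n))"
  proof (intro exI conjI)
    show "splitting_tree S'" "S' \<subseteq> T" using S' S(2) by auto
    show "infinite (range \<nu>)" using strict_mono_imp_inj_on[OF \<nu>] by (simp add: range_inj_infinite)
    show "\<forall>n\<in>range \<nu>. finite (H n) \<and> card (H n) = g n" using B(1,2) by (auto simp: H)
    show "S' \<tturnstile> f_all (range \<nu>) (\<lambda>n. f_value_in (value_name T f x_gen) n (H n))"
      using S'(1) forced unfolding forces_def f_all_def by blast
  qed
qed

lemma wsacks_cont_if_wsacks_baire: "wsacks_baire T \<Longrightarrow> wsacks_cont T"
  unfolding wsacks_baire_def wsacks_cont_def wsacks_def
  using baire_measurable_on_continuous by blast

theorem theorem2p9: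
  fixes T :: tree
  assumes "splitting_tree T"
  shows "(wsacks_baire T \<longleftrightarrow> wsacks_cont T) \<and>
    (wsacks_cont T \<longleftrightarrow>
      (\<exists>S. splitting_tree S \<and> S \<subseteq> T \<and> (\<forall>s\<in>S. finitely_covering (restrict_tree S s))))"
  using subtree_if_wsacks_cont[OF assms] wsacks_baire_if_subtree wsacks_cont_if_wsacks_baire
  by metis

end
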